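(* Let $G$ be a group and let $R$ be a $G$-graded ring of finite support (i.e., $R_g\neq 0$ for only finitely many $g\in G$). Then $R$ is graded quasi-Frobenius if and only if $R$ is a quasi-Frobenius ring.
   Context: Rings are associative with identity. A $G$-graded ring is a ring $R=\bigoplus_{g\in G}R_g$ with $R_gR_h\subset R_{gh}$. $R-gr$ is the category of graded left $R$-modules $M=\bigoplus_g M_g$ ($R_gM_h\subset M_{gh}$) with degree-preserving $R$-linear maps. $R$ is called graded quasi-Frobenius if it is graded left Noetherian (ACC on graded left ideals) and injective as an object of $R-gr$; equivalently, if $R$ satisfies DCC on graded left ideals and on graded right ideals and $\mathrm{ann}_r(\mathrm{ann}_\ell(A))=A$, $\mathrm{ann}_\ell(\mathrm{ann}_r(U))=U$ for all graded right ideals $A$ and graded left ideals $U$. A ring is quasi-Frobenius if it is left Noetherian and injective as a left module over itself. *)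

theory Defs
  imports "HOL-Algebra.Module" "HOL-Algebra.AbelCoset"
begin

section \<open>Left modules over arbitrary rings\<close>

text \<open>The library locale \<^locale>\<open>module\<close> requires a commutative ring of scalars. The
  library predicate \<^const>\<open>submodule\<close> does not, and it is used below as it is.\<close>

locale left_module = R?: ring R + M?: abelian_group M for R (structure) and M (structure) +
  assumes smult_closed [simp, intro]:
      "\<lbrakk>a \<in> carrier R; x \<in> carrier M\<rbrakk> \<Longrightarrow> a \<odot>\<^bsub>M\<^esub> x \<in> carrier M"
    and smult_l_distr:
      "\<lbrakk>a \<in> carrier R; b \<in> carrier R; x \<in> carrier M\<rbrakk> \<Longrightarrow>
        (a \<oplus> b) \<odot>\<^bsub>M\<^esub> x = a \<odot>\<^bsub>M\<^esub> x \<oplus>\<^bsub>M\<^esub> b \<odot>\<^bsub>M\<^esub> x"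
    and smult_r_distr:
      "\<lbrakk>a \<in> carrier R; x \<in> carrier M; y \<in> carrier M\<rbrakk> \<Longrightarrow>
        a \<odot>\<^bsub>M\<^esub> (x \<oplus>\<^bsub>M\<^esub> y) = a \<odot>\<^bsub>M\<^esub> x \<oplus>\<^bsub>M\<^esub> a \<odot>\<^bsub>M\<^esub> y"
    and smult_assoc1:
      "\<lbrakk>a \<in> carrier R; b \<in> carrier R; x \<in> carrier M\<rbrakk> \<Longrightarrow>
        (a \<otimes> b) \<odot>\<^bsub>M\<^esub> x = a \<odot>\<^bsub>M\<^esub> (b \<odot>\<^bsub>M\<^esub> x)"
    and smult_one [simp]:
      "x \<in> carrier M \<Longrightarrow> \<one> \<odot>\<^bsub>M\<^esub> x = x"

definition left_module_hom ::
  "('a, 'r) ring_scheme \<Rightarrow> ('a, 'm, 'x) module_scheme \<Rightarrow> ('a, 'n, 'y) module_scheme \<Rightarrow> ('m \<Rightarrow> 'n) set"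
  where "left_module_hom R M N =
    {f \<in> carrier M \<rightarrow> carrier N.
      (\<forall>x\<in>carrier M. \<forall>y\<in>carrier M. f (x \<oplus>\<^bsub>M\<^esub> y) = f x \<oplus>\<^bsub>N\<^esub> f y) \<and>
      (\<forall>a\<in>carrier R. \<forall>x\<in>carrier M. f (a \<odot>\<^bsub>M\<^esub> x) = a \<odot>\<^bsub>N\<^esub> f x)}"

definition regular_module :: "('a, 'r) ring_scheme \<Rightarrow> ('a, 'a) module"
  where "regular_module R =
    \<lparr>carrier = carrier R, mult = mult R, one = one R, zero = zero R, add = add R, smult = mult R\<rparr>"

lemma regular_module_simps [simp]:
  "carrier (regular_module R) = carrier R"
  "zero (regular_module R) = zero R"
  "add (regular_module R) = add R"
  "smult (regular_module R) = mult R"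
  by (simp_all add: regular_module_def)

lemma (in ring) left_module_regular_module: "left_module R (regular_module R)"
proof -
  have "abelian_group (regular_module R)"
    by (rule abelian_groupI) (auto simp: a_ac intro: l_neg exI[of _ "\<ominus> _"] bexI[of _ "\<ominus> _"])
  then show ?thesis
    by (auto simp: left_module_def left_module_axioms_def l_distr r_distr m_assoc ring_axioms)
qed

abbreviation left_ideal :: "'a set \<Rightarrow> ('a, 'r) ring_scheme \<Rightarrow> bool"
  where "left_ideal I R \<equiv> submodule I R (regular_module R)"


section \<open>Gradings\<close>

text \<open>\<open>A\<close> is the internal direct sum of the additive subgroups \<open>X i\<close>. The sum is taken over
  the support of \<open>c\<close>, because \<^const>\<open>finsum\<close> over an infinite index set is zero by convention.\<close>

definition internal_direct_sum :: "('m, 'x) ring_scheme \<Rightarrow> 'i set \<Rightarrow> ('i \<Rightarrow> 'm set) \<Rightarrow> bool"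
  where "internal_direct_sum A I X \<longleftrightarrow>
    (\<forall>i\<in>I. additive_subgroup (X i) A) \<and>
    (\<forall>a\<in>carrier A. \<exists>!c. c \<in> (\<Pi>\<^sub>E i\<in>I. X i) \<and> finite {i\<in>I. c i \<noteq> \<zero>\<^bsub>A\<^esub>} \<and>
      a = (\<Oplus>\<^bsub>A\<^esub>i\<in>{i\<in>I. c i \<noteq> \<zero>\<^bsub>A\<^esub>}. c i))"

text \<open>The values of a grading at indices outside \<open>carrier G\<close> are irrelevant.\<close>

definition graded_ring ::
  "('g, 'b) monoid_scheme \<Rightarrow> ('a, 'r) ring_scheme \<Rightarrow> ('g \<Rightarrow> 'a set) \<Rightarrow> bool"
  where "graded_ring G R Rgr \<longleftrightarrow>
    ring R \<and> internal_direct_sum R (carrier G) Rgr \<and>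
    (\<forall>g\<in>carrier G. \<forall>h\<in>carrier G. \<forall>a\<in>Rgr g. \<forall>b\<in>Rgr h. a \<otimes>\<^bsub>R\<^esub> b \<in> Rgr (g \<otimes>\<^bsub>G\<^esub> h))"

definition finite_support ::
  "('g, 'b) monoid_scheme \<Rightarrow> ('a, 'r) ring_scheme \<Rightarrow> ('g \<Rightarrow> 'a set) \<Rightarrow> bool"
  where "finite_support G R Rgr \<longleftrightarrow> finite {g\<in>carrier G. Rgr g \<noteq> {\<zero>\<^bsub>R\<^esub>}}"

definition graded_left_module ::
  "('g, 'b) monoid_scheme \<Rightarrow> ('a, 'r) ring_scheme \<Rightarrow> ('g \<Rightarrow> 'a set) \<Rightarrow>
    ('a, 'm, 'x) module_scheme \<Rightarrow> ('g \<Rightarrow> 'm set) \<Rightarrow> bool"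
  where "graded_left_module G R Rgr M Mgr \<longleftrightarrow>
    left_module R M \<and> internal_direct_sum M (carrier G) Mgr \<and>
    (\<forall>g\<in>carrier G. \<forall>h\<in>carrier G. \<forall>a\<in>Rgr g. \<forall>x\<in>Mgr h. a \<odot>\<^bsub>M\<^esub> x \<in> Mgr (g \<otimes>\<^bsub>G\<^esub> h))"

definition graded_hom ::
  "('g, 'b) monoid_scheme \<Rightarrow> ('a, 'r) ring_scheme \<Rightarrow>
    ('a, 'm, 'x) module_scheme \<Rightarrow> ('g \<Rightarrow> 'm set) \<Rightarrow>
    ('a, 'n, 'y) module_scheme \<Rightarrow> ('g \<Rightarrow> 'n set) \<Rightarrow> ('m \<Rightarrow> 'n) set"
  where "graded_hom G R M Mgr N Ngr =
    {f \<in> left_module_hom R M N. \<forall>g\<in>carrier G. f ` Mgr g \<subseteq> Ngr g}"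

text \<open>A left ideal \<open>I\<close> is graded if it is the direct sum of its subgroups \<open>I \<inter> R\<^sub>g\<close>.\<close>

definition graded_left_ideal ::
  "('g, 'b) monoid_scheme \<Rightarrow> ('a, 'r) ring_scheme \<Rightarrow> ('g \<Rightarrow> 'a set) \<Rightarrow> 'a set \<Rightarrow> bool"
  where "graded_left_ideal G R Rgr I \<longleftrightarrow>
    left_ideal I R \<and> internal_direct_sum (R\<lparr>carrier := I\<rparr>) (carrier G) (\<lambda>g. I \<inter> Rgr g)"


section \<open>Noetherian and injective\<close>

definition left_noetherian :: "('a, 'r) ring_scheme \<Rightarrow> bool"
  where "left_noetherian R \<longleftrightarrow>
    (\<forall>I :: nat \<Rightarrow> 'a set. (\<forall>n. left_ideal (I n) R) \<and> (\<forall>n. I n \<subseteq> I (Suc n)) \<longrightarrow>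
      (\<exists>n. \<forall>m\<ge>n. I m = I n))"

definition graded_left_noetherian ::
  "('g, 'b) monoid_scheme \<Rightarrow> ('a, 'r) ring_scheme \<Rightarrow> ('g \<Rightarrow> 'a set) \<Rightarrow> bool"
  where "graded_left_noetherian G R Rgr \<longleftrightarrow>
    (\<forall>I :: nat \<Rightarrow> 'a set. (\<forall>n. graded_left_ideal G R Rgr (I n)) \<and> (\<forall>n. I n \<subseteq> I (Suc n)) \<longrightarrow>
      (\<exists>n. \<forall>m\<ge>n. I m = I n))"

text \<open>A HOL formula cannot quantify over types, so injectivity is relative to a universe: the
  type argument \<open>'u\<close> is the type from which the elements of the test modules \<open>N\<close> and \<open>M\<close> are
  drawn. Injectivity in the usual sense is injectivity for every \<open>'u\<close>. A universe too small
  to contain a copy of the ring would make the notion too weak (it is vacuous for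
  \<^typ>\<open>unit\<close>), whereas one of the form \<open>'a + 'v\<close>, with \<open>'a\<close> the type of the ring, contains a
  copy of the ring and of every module over the arbitrary type \<open>'v\<close>.

  The monomorphisms of left modules and of graded left modules are the injective
  homomorphisms.\<close>

definition injective_module ::
  "'u itself \<Rightarrow> ('a, 'r) ring_scheme \<Rightarrow> ('a, 'e, 'x) module_scheme \<Rightarrow> bool"
  where "injective_module (_ :: 'u itself) R E \<longleftrightarrow>
    left_module R E \<and>
    (\<forall>(N :: ('a, 'u) module) (M :: ('a, 'u) module) i f.
      left_module R N \<and> left_module R M \<and>
      i \<in> left_module_hom R N M \<and> inj_on i (carrier N) \<and> f \<in> left_module_hom R N E \<longrightarrow>
      (\<exists>h \<in> left_module_hom R M E. \<forall>x\<in>carrier N. h (i x) = f x))"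

definition graded_injective_module ::
  "'u itself \<Rightarrow> ('g, 'b) monoid_scheme \<Rightarrow> ('a, 'r) ring_scheme \<Rightarrow> ('g \<Rightarrow> 'a set) \<Rightarrow>
    ('a, 'e, 'x) module_scheme \<Rightarrow> ('g \<Rightarrow> 'e set) \<Rightarrow> bool"
  where "graded_injective_module (_ :: 'u itself) G R Rgr E Egr \<longleftrightarrow>
    graded_left_module G R Rgr E Egr \<and>
    (\<forall>(N :: ('a, 'u) module) Ngr (M :: ('a, 'u) module) Mgr i f.
      graded_left_module G R Rgr N Ngr \<and> graded_left_module G R Rgr M Mgr \<and>
      i \<in> graded_hom G R N Ngr M Mgr \<and> inj_on i (carrier N) \<and>
      f \<in> graded_hom G R N Ngr E Egr \<longrightarrow>
      (\<exists>h \<in> graded_hom G R M Mgr E Egr. \<forall>x\<in>carrier N. h (i x) = f x))"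


section \<open>Quasi-Frobenius rings\<close>

definition quasi_frobenius :: "'u itself \<Rightarrow> ('a, 'r) ring_scheme \<Rightarrow> bool"
  where "quasi_frobenius U R \<longleftrightarrow>
    ring R \<and> left_noetherian R \<and> injective_module U R (regular_module R)"

definition graded_quasi_frobenius ::
  "'u itself \<Rightarrow> ('g, 'b) monoid_scheme \<Rightarrow> ('a, 'r) ring_scheme \<Rightarrow> ('g \<Rightarrow> 'a set) \<Rightarrow> bool"
  where "graded_quasi_frobenius U G R Rgr \<longleftrightarrow>
    graded_ring G R Rgr \<and> graded_left_noetherian G R Rgr \<and>
    graded_injective_module U G R Rgr (regular_module R) Rgr"

end

theory Submission
  imports Defs
begin

text \<open>The group of degrees may be infinite, but the support \<open>S\<close> of \<open>R\<close> is finite. For a left ideal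
  \<open>I\<close> and a set \<open>T\<close> of degrees, consider the elements \<open>x \<in> I\<close> with \<open>x\<^sub>s = 0\<close> unless
  \<open>s\<inverse> g \<in> T\<close>; they form a window \<open>W T g\<close>. Enlarging \<open>T\<close> by one degree \<open>h\<close> gives access to one more
  component \<open>x\<^sub>t\<close>, where \<open>t = g h\<inverse>\<close>, and the components that occur in this way are the homogeneous
  elements of a graded left ideal. By induction on \<open>T\<close>, chains of left ideals stabilise on windows
  if graded left ideals satisfy the ascending chain condition. Likewise, if \<open>f : I \<rightarrow> R\<close> is linear
  and every \<open>f(x)\<^sub>g\<close> with \<open>x \<in> W T g\<close> is already \<open>0\<close>, then \<open>x\<^sub>t \<mapsto> f(x)\<^sub>g\<close> is well defined on
  \<open>W (T \<union> {h}) g\<close>, and it is a homomorphism of degree \<open>h\<close>, hence a right multiplication by graded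
  injectivity; so \<open>f\<close> is corrected one degree at a time. A finite \<open>T\<close> sees all of \<open>I\<close>, which gives
  Baer's condition.

  Conversely, a linear extension of a graded homomorphism into \<open>R\<close> can be replaced by its
  degree-preserving part. Baer's criterion also makes injectivity independent of the universe
  from which the test modules are drawn.\<close>

section \<open>Components of an internal direct sum\<close>

text \<open>The projection onto the summand with index \<open>i\<close>. The definite description is
  meaningful for \<open>a\<close> in the carrier, where the internal direct sum supplies a unique
  coefficient family; membership in \<open>PiE\<close> fixes its values outside \<open>I\<close>, so
  that uniqueness is not spoilt there.\<close>

definition component ::
  "('m, 'x) ring_scheme \<Rightarrow> 'i set \<Rightarrow> ('i \<Rightarrow> 'm set) \<Rightarrow> 'i \<Rightarrow> 'm \<Rightarrow> 'm"
  where "component A I X i a =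
    (THE c. c \<in> (\<Pi>\<^sub>E i\<in>I. X i) \<and> finite {i\<in>I. c i \<noteq> \<zero>\<^bsub>A\<^esub>} \<and>
      a = (\<Oplus>\<^bsub>A\<^esub>i\<in>{i\<in>I. c i \<noteq> \<zero>\<^bsub>A\<^esub>}. c i)) i"

lemma additive_hom_finsum:
  assumes "abelian_group A" "abelian_group B" "finite F" "d \<in> F \<rightarrow> carrier A"
    and f: "f \<in> carrier A \<rightarrow> carrier B"
    and add: "\<And>x y. x \<in> carrier A \<Longrightarrow> y \<in> carrier A \<Longrightarrow> f (x \<oplus>\<^bsub>A\<^esub> y) = f x \<oplus>\<^bsub>B\<^esub> f y"
  shows "f (\<Oplus>\<^bsub>A\<^esub>i\<in>F. d i) = (\<Oplus>\<^bsub>B\<^esub>i\<in>F. f (d i))"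
proof -
  interpret A: abelian_group A by fact
  interpret B: abelian_group B by fact
  have zero: "f \<zero>\<^bsub>A\<^esub> = \<zero>\<^bsub>B\<^esub>"
    using add[of "\<zero>\<^bsub>A\<^esub>" "\<zero>\<^bsub>A\<^esub>"] f by (auto simp: Pi_iff)
  show ?thesis using \<open>finite F\<close> \<open>d \<in> F \<rightarrow> carrier A\<close>
  proof induction
    case empty
    then show ?case by (simp add: zero)
  next
    case (insert x F)
    then have "(\<lambda>i. f (d i)) \<in> F \<rightarrow> carrier B" "f (d x) \<in> carrier B"
      using f by (auto simp: Pi_iff)
    with insert show ?case by (simp add: add Pi_iff)
  qed
qed

locale direct_sum = abelian_group A for A (structure) +
  fixes I :: "'i set" and X :: "'i \<Rightarrow> 'a set"
  assumes internal_direct_sum: "internal_direct_sum A I X"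
begin

abbreviation "proj \<equiv> component A I X"

lemma homogeneous_subgroup: "i \<in> I \<Longrightarrow> additive_subgroup (X i) A"
  using internal_direct_sum by (simp add: internal_direct_sum_def)

lemma homogeneous_closed [simp]: "x \<in> X i \<Longrightarrow> i \<in> I \<Longrightarrow> x \<in> carrier A"
  using additive_subgroup.a_subset[OF homogeneous_subgroup] by blast

lemma zero_homogeneous [simp]: "i \<in> I \<Longrightarrow> \<zero> \<in> X i"
  using additive_subgroup.zero_closed[OF homogeneous_subgroup] .

lemma add_homogeneous: "x \<in> X i \<Longrightarrow> y \<in> X i \<Longrightarrow> i \<in> I \<Longrightarrow> x \<oplus> y \<in> X i"
  using additive_subgroup.a_closed[OF homogeneous_subgroup] .

text \<open>Uniqueness in \<open>internal_direct_sum\<close> forces the definite description to pick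
  \<open>c\<close>, so any explicit decomposition reveals the components.\<close>

lemma proj_eq:
  assumes "c \<in> (\<Pi>\<^sub>E i\<in>I. X i)" "finite {i\<in>I. c i \<noteq> \<zero>}" "a = (\<Oplus>i\<in>{i\<in>I. c i \<noteq> \<zero>}. c i)"
  shows "proj i a = c i"
proof -
  have "a \<in> carrier A"
    unfolding assms(3) using assms(1) by (intro finsum_closed) (auto intro: homogeneous_closed PiE_mem)
  then have "\<exists>!c. c \<in> (\<Pi>\<^sub>E i\<in>I. X i) \<and> finite {i\<in>I. c i \<noteq> \<zero>} \<and> a = (\<Oplus>i\<in>{i\<in>I. c i \<noteq> \<zero>}. c i)"
    using internal_direct_sum unfolding internal_direct_sum_def by blast
  then show ?thesis
    unfolding component_def using assms by (subst the1_equality[of _ c]) auto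
qed

lemma
  assumes "a \<in> carrier A"
  shows proj_homogeneous [simp]: "i \<in> I \<Longrightarrow> proj i a \<in> X i"
    and finite_support_proj: "finite {i\<in>I. proj i a \<noteq> \<zero>}"
    and finsum_proj: "a = (\<Oplus>i\<in>{i\<in>I. proj i a \<noteq> \<zero>}. proj i a)"
proof -
  obtain c where c: "c \<in> (\<Pi>\<^sub>E i\<in>I. X i)" "finite {i\<in>I. c i \<noteq> \<zero>}"
      "a = (\<Oplus>i\<in>{i\<in>I. c i \<noteq> \<zero>}. c i)"
    using internal_direct_sum assms unfolding internal_direct_sum_def by blast
  have "proj i a = c i" for i using c by (rule proj_eq)
  then show "i \<in> I \<Longrightarrow> proj i a \<in> X i" "finite {i\<in>I. proj i a \<noteq> \<zero>}"
    "a = (\<Oplus>i\<in>{i\<in>I. proj i a \<noteq> \<zero>}. proj i a)"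
    using c by (auto simp: \<open>\<And>i. proj i a = c i\<close> PiE_mem)
qed

lemma proj_closed [simp]: "a \<in> carrier A \<Longrightarrow> i \<in> I \<Longrightarrow> proj i a \<in> carrier A"
  by (rule homogeneous_closed[OF proj_homogeneous])

lemma finsum_proj_superset:
  assumes "a \<in> carrier A" "finite F" "F \<subseteq> I" "{i\<in>I. proj i a \<noteq> \<zero>} \<subseteq> F"
  shows "(\<Oplus>i\<in>F. proj i a) = a"
proof -
  have "(\<Oplus>i\<in>{i\<in>I. proj i a \<noteq> \<zero>}. proj i a) = (\<Oplus>i\<in>F. proj i a)"
    using assms by (intro add.finprod_mono_neutral_cong_left) auto
  with finsum_proj[OF assms(1)] show ?thesis by simp
qed

lemma proj_finsum:
  assumes "finite F" "F \<subseteq> I" and d: "\<And>j. j \<in> F \<Longrightarrow> d j \<in> X j" and "i \<in> I"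
  shows "proj i (\<Oplus>j\<in>F. d j) = (if i \<in> F then d i else \<zero>)"
proof -
  \<comment> \<open>Padding by zero turns \<open>d\<close> into a family on all of \<open>I\<close>.
    Its support may be smaller than \<open>F\<close>, since some \<open>d j\<close> may
    vanish.\<close>
  define c where "c = (\<lambda>i\<in>I. if i \<in> F then d i else \<zero>)"
  have sub: "{i\<in>I. c i \<noteq> \<zero>} \<subseteq> F" by (auto simp: c_def)
  have "(\<Oplus>i\<in>{i\<in>I. c i \<noteq> \<zero>}. c i) = (\<Oplus>j\<in>F. d j)"
    using assms sub by (intro add.finprod_mono_neutral_cong_left) (auto simp: c_def subset_iff intro: homogeneous_closed)
  moreover have "c \<in> (\<Pi>\<^sub>E i\<in>I. X i)" using d by (auto simp: c_def)
  moreover have "finite {i\<in>I. c i \<noteq> \<zero>}" using sub assms(1) finite_subset by blast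
  ultimately have "proj i (\<Oplus>j\<in>F. d j) = c i" by (intro proj_eq) auto
  with \<open>i \<in> I\<close> show ?thesis by (simp add: c_def)
qed

lemma proj_of_homogeneous:
  assumes "x \<in> X j" "i \<in> I" "j \<in> I"
  shows "proj i x = (if i = j then x else \<zero>)"
  using proj_finsum[of "{j}" "\<lambda>_. x" i] assms by simp

lemma proj_same [simp]: "x \<in> X i \<Longrightarrow> i \<in> I \<Longrightarrow> proj i x = x"
  by (simp add: proj_of_homogeneous)

lemma proj_zero [simp]: "i \<in> I \<Longrightarrow> proj i \<zero> = \<zero>"
  using proj_of_homogeneous[of \<zero> i i] by simp

lemma proj_proj: "a \<in> carrier A \<Longrightarrow> i \<in> I \<Longrightarrow> j \<in> I \<Longrightarrow> proj i (proj j a) = (if i = j then proj j a else \<zero>)"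
  by (rule proj_of_homogeneous) auto

lemma proj_add [simp]:
  assumes "a \<in> carrier A" "b \<in> carrier A" "i \<in> I"
  shows "proj i (a \<oplus> b) = proj i a \<oplus> proj i b"
proof -
  \<comment> \<open>A common finite index set lets both decompositions be added term by
    term.\<close>
  define F where "F = {i\<in>I. proj i a \<noteq> \<zero>} \<union> {i\<in>I. proj i b \<noteq> \<zero>}"
  have F: "finite F" "F \<subseteq> I" using assms by (auto simp: F_def finite_support_proj)
  have "a \<oplus> b = (\<Oplus>i\<in>F. proj i a) \<oplus> (\<Oplus>i\<in>F. proj i b)"
    using assms F by (simp add: finsum_proj_superset F_def)
  also have "\<dots> = (\<Oplus>i\<in>F. proj i a \<oplus> proj i b)"
    using assms F by (intro finsum_addf[symmetric]) auto
  finally have "proj i (a \<oplus> b) = (if i \<in> F then proj i a \<oplus> proj i b else \<zero>)"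
    using proj_finsum[OF F, of "\<lambda>i. proj i a \<oplus> proj i b" i] assms F
    by (auto simp: add_homogeneous subset_iff)
  then show ?thesis using assms by (auto simp: F_def)
qed

lemma proj_a_inv [simp]:
  assumes "a \<in> carrier A" "i \<in> I"
  shows "proj i (\<ominus> a) = \<ominus> proj i a"
proof -
  have "proj i (\<ominus> a) \<oplus> proj i a = proj i (\<ominus> a \<oplus> a)"
    using assms proj_add by (metis a_inv_closed)
  also have "\<dots> = \<zero>" using assms by (simp add: l_neg)
  finally show ?thesis using assms by (intro minus_equality[symmetric]) auto
qed

lemma proj_minus [simp]:
  "a \<in> carrier A \<Longrightarrow> b \<in> carrier A \<Longrightarrow> i \<in> I \<Longrightarrow> proj i (a \<ominus> b) = proj i a \<ominus> proj i b"
  by (simp add: minus_eq)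

lemma proj_ext:
  assumes "a \<in> carrier A" "b \<in> carrier A" "\<And>i. i \<in> I \<Longrightarrow> proj i a = proj i b"
  shows "a = b"
proof -
  have eq: "{i\<in>I. proj i a \<noteq> \<zero>} = {i\<in>I. proj i b \<noteq> \<zero>}" using assms(3) by auto
  have "(\<Oplus>i\<in>{i\<in>I. proj i a \<noteq> \<zero>}. proj i a) = (\<Oplus>i\<in>{i\<in>I. proj i b \<noteq> \<zero>}. proj i b)"
    using assms by (intro finsum_cong'[OF eq]) auto
  then show ?thesis by (simp only: finsum_proj[OF assms(1), symmetric] finsum_proj[OF assms(2), symmetric])
qed

text \<open>Every element is a finite sum of its components, and the partial sums are handled by
  induction. Statements additive in one argument thereby reduce to a homogeneous argument.\<close>

lemma homogeneous_induct [consumes 1, case_names zero homogeneous add]: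
  assumes "a \<in> carrier A" "P \<zero>" "\<And>i x. i \<in> I \<Longrightarrow> x \<in> X i \<Longrightarrow> P x"
    and "\<And>x y. x \<in> carrier A \<Longrightarrow> y \<in> carrier A \<Longrightarrow> P x \<Longrightarrow> P y \<Longrightarrow> P (x \<oplus> y)"
  shows "P a"
proof -
  have "P (\<Oplus>i\<in>F. proj i a)" if "finite F" "F \<subseteq> I" for F
    using that
  proof induction
    case empty
    then show ?case using assms(2) by simp
  next
    case (insert j F)
    then have "(\<lambda>i. proj i a) \<in> F \<rightarrow> carrier A" using assms(1) by auto
    with insert show ?case
      using assms(1) by (simp add: assms(4) assms(3)[of j])
  qed
  from this[OF finite_support_proj[OF assms(1)]] show ?thesis
    using finsum_proj[OF assms(1)] by auto
qed

text \<open>\<open>f\<close> identifies \<open>B\<close> with a subgroup of \<open>A\<close> that is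
  closed under all projections, so decompositions in \<open>A\<close> stay inside it and can be
  pulled back. The bijection \<open>\<sigma>\<close> renames degrees. Graded left ideals, the
  regular module and degree-shifted copies are all instances.\<close>

lemma internal_direct_sum_pullback:
  assumes "abelian_group B" and f: "f \<in> carrier B \<rightarrow> carrier A" and inj: "inj_on f (carrier B)"
    and add: "\<And>x y. x \<in> carrier B \<Longrightarrow> y \<in> carrier B \<Longrightarrow> f (x \<oplus>\<^bsub>B\<^esub> y) = f x \<oplus> f y"
    and \<sigma>: "bij_betw \<sigma> K I"
    and Y: "\<And>k. k \<in> K \<Longrightarrow> Y k = {x\<in>carrier B. f x \<in> X (\<sigma> k)}"
    and stable: "\<And>x i. x \<in> carrier B \<Longrightarrow> i \<in> I \<Longrightarrow> proj i (f x) \<in> f ` carrier B"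
  shows "internal_direct_sum B K Y"
  unfolding internal_direct_sum_def
proof (intro conjI ballI)
  interpret B: abelian_group B by fact
  have zero: "f \<zero>\<^bsub>B\<^esub> = \<zero>"
    using add[of "\<zero>\<^bsub>B\<^esub>" "\<zero>\<^bsub>B\<^esub>"] f by (auto simp: Pi_iff)
  have inv: "f (\<ominus>\<^bsub>B\<^esub> x) = \<ominus> f x" if "x \<in> carrier B" for x
  proof -
    have "f (\<ominus>\<^bsub>B\<^esub> x) \<oplus> f x = \<zero>"
      using that add[of "\<ominus>\<^bsub>B\<^esub> x" x] by (simp add: B.l_neg zero)
    then show ?thesis using that f by (intro minus_equality[symmetric]) auto
  qed
  have \<sigma>I: "\<sigma> k \<in> I" if "k \<in> K" for k using \<sigma> that by (auto simp: bij_betw_def)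
  show "additive_subgroup (Y k) B" if k: "k \<in> K" for k
  proof -
    interpret X: additive_subgroup "X (\<sigma> k)" A by (rule homogeneous_subgroup[OF \<sigma>I[OF k]])
    show ?thesis
      unfolding additive_subgroup_def
      using k add zero inv X.a_inv_closed
      by (intro B.add.subgroupI) (auto simp: Y a_inv_def[symmetric])
  qed
  fix b assume b: "b \<in> carrier B"
  \<comment> \<open>The coefficients are computed in \<open>A\<close>; by \<open>stable\<close> they
    lie in the image of \<open>f\<close> and can be taken back to \<open>B\<close>.\<close>
  define c where "c = (\<lambda>k\<in>K. inv_into (carrier B) f (proj (\<sigma> k) (f b)))"
  have fb: "f b \<in> carrier A" using f b by auto
  have c: "c k \<in> carrier B" "f (c k) = proj (\<sigma> k) (f b)" if "k \<in> K" for k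
    using stable[OF b \<sigma>I[OF that]] that
    by (auto simp: c_def inv_into_into f_inv_into_f)
  have cY: "c \<in> (\<Pi>\<^sub>E k\<in>K. Y k)"
    using c fb \<sigma>I by (auto simp: Y) (simp_all add: c_def)
  have c0: "c k = \<zero>\<^bsub>B\<^esub> \<longleftrightarrow> proj (\<sigma> k) (f b) = \<zero>" if "k \<in> K" for k
    using c[OF that] zero inj by (metis B.zero_closed inj_on_eq_iff)
  have supp: "\<sigma> ` {k\<in>K. c k \<noteq> \<zero>\<^bsub>B\<^esub>} = {i\<in>I. proj i (f b) \<noteq> \<zero>}"
    using \<sigma> c0 by (force simp: bij_betw_def)
  have inj\<sigma>: "inj_on \<sigma> J" if "J \<subseteq> K" for J
    using \<sigma> that by (auto simp: bij_betw_def intro: inj_on_subset)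
  have fin: "finite {k\<in>K. c k \<noteq> \<zero>\<^bsub>B\<^esub>}"
    using finite_support_proj[OF fb] unfolding supp[symmetric]
    by (rule finite_imageD) (auto intro: inj\<sigma>)
  \<comment> \<open>Transport of a finite sum along \<open>f\<close>, reindexed by
    \<open>\<sigma>\<close>; it serves both the existence and the uniqueness of the
    decomposition.\<close>
  have comp: "f (\<Oplus>\<^bsub>B\<^esub>k\<in>F. d k) = (\<Oplus>i\<in>\<sigma> ` F. f (d (inv_into K \<sigma> i)))"
    if "finite F" "F \<subseteq> K" "d \<in> F \<rightarrow> carrier B" for F d
  proof -
    have "f (\<Oplus>\<^bsub>B\<^esub>k\<in>F. d k) = (\<Oplus>k\<in>F. f (d k))"
      using that add f by (intro additive_hom_finsum) (auto intro: B.abelian_group_axioms abelian_group_axioms)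
    also have "\<dots> = (\<Oplus>k\<in>F. f (d (inv_into K \<sigma> (\<sigma> k))))"
      using that f inj\<sigma>[of K] by (intro finsum_cong') (auto simp: subset_iff Pi_iff)
    also have "\<dots> = (\<Oplus>i\<in>\<sigma> ` F. f (d (inv_into K \<sigma> i)))"
      using that f inj\<sigma>[of K] by (intro finsum_reindex[symmetric] inj\<sigma>) (auto simp: subset_iff Pi_iff)
    finally show ?thesis .
  qed
  have "f (\<Oplus>\<^bsub>B\<^esub>k\<in>{k\<in>K. c k \<noteq> \<zero>\<^bsub>B\<^esub>}. c k) = (\<Oplus>i\<in>{i\<in>I. proj i (f b) \<noteq> \<zero>}. f (c (inv_into K \<sigma> i)))"
    using comp[OF fin, of c] c by (simp add: supp)
  also have "\<dots> = (\<Oplus>i\<in>{i\<in>I. proj i (f b) \<noteq> \<zero>}. proj i (f b))"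
    using \<sigma> fb by (intro finsum_cong') (auto simp: bij_betw_def c inv_into_into f_inv_into_f)
  also have "\<dots> = f b" using finsum_proj[OF fb] by simp
  finally have sum: "b = (\<Oplus>\<^bsub>B\<^esub>k\<in>{k\<in>K. c k \<noteq> \<zero>\<^bsub>B\<^esub>}. c k)"
    using b c inj by (intro inj_onD[OF inj]) (auto intro!: B.finsum_closed)
  show "\<exists>!c. c \<in> (\<Pi>\<^sub>E k\<in>K. Y k) \<and> finite {k\<in>K. c k \<noteq> \<zero>\<^bsub>B\<^esub>} \<and>
      b = (\<Oplus>\<^bsub>B\<^esub>k\<in>{k\<in>K. c k \<noteq> \<zero>\<^bsub>B\<^esub>}. c k)"
  proof (rule ex1I[of _ c])
    show "c \<in> (\<Pi>\<^sub>E k\<in>K. Y k) \<and> finite {k\<in>K. c k \<noteq> \<zero>\<^bsub>B\<^esub>} \<and>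
      b = (\<Oplus>\<^bsub>B\<^esub>k\<in>{k\<in>K. c k \<noteq> \<zero>\<^bsub>B\<^esub>}. c k)" using cY fin sum by blast
    fix d assume d: "d \<in> (\<Pi>\<^sub>E k\<in>K. Y k) \<and> finite {k\<in>K. d k \<noteq> \<zero>\<^bsub>B\<^esub>} \<and>
      b = (\<Oplus>\<^bsub>B\<^esub>k\<in>{k\<in>K. d k \<noteq> \<zero>\<^bsub>B\<^esub>}. d k)"
    let ?F = "{k\<in>K. d k \<noteq> \<zero>\<^bsub>B\<^esub>}"
    have dY: "d k \<in> carrier B" "f (d k) \<in> X (\<sigma> k)" if "k \<in> K" for k using d that Y by auto
    have fd: "f b = (\<Oplus>i\<in>\<sigma> ` ?F. f (d (inv_into K \<sigma> i)))"
      using comp[of ?F d] d dY by (auto simp: Pi_iff)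
    \<comment> \<open>Projecting any other decomposition \<open>d\<close> of \<open>b\<close> to
      degree \<open>\<sigma> k\<close> recovers \<open>f (d k)\<close>, which must therefore agree
      with \<open>f (c k)\<close>.\<close>
    have "f (d k) = f (c k)" if k: "k \<in> K" for k
    proof -
      have "proj (\<sigma> k) (f b) = (if \<sigma> k \<in> \<sigma> ` ?F then f (d (inv_into K \<sigma> (\<sigma> k))) else \<zero>)"
        unfolding fd using d k inj\<sigma>[of K] dY \<sigma>I by (intro proj_finsum) auto
      also have "\<dots> = f (d k)"
        using k inj\<sigma>[of K] zero by (auto simp: inj_on_eq_iff)
      finally show ?thesis using c k by simp
    qed
    then have "d k = c k" if "k \<in> K" for k using inj_onD[OF inj] that dY c by blast
    then show "d = c" using d cY by (intro PiE_ext) auto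
  qed
qed

end

section \<open>Baer's criterion\<close>

text \<open>Both sides of the first equation are rewritten with the common summand
  \<open>a \<oplus> d\<close>, which is then cancelled. This is the rearrangement behind
  single-valuedness in the extension step of Baer's criterion.\<close>

lemma (in abelian_group) add_eq_add_iff:
  assumes "a \<in> carrier G" "b \<in> carrier G" "c \<in> carrier G" "d \<in> carrier G"
  shows "a \<oplus> b = c \<oplus> d \<longleftrightarrow> b \<oplus> \<ominus> d = c \<oplus> \<ominus> a"
proof -
  have "a \<oplus> b = (a \<oplus> d) \<oplus> (b \<oplus> \<ominus> d)"
  proof -
    have "(a \<oplus> d) \<oplus> (b \<oplus> \<ominus> d) = (a \<oplus> b) \<oplus> (d \<oplus> \<ominus> d)" using assms by (simp add: a_ac del: r_neg)
    then show ?thesis using assms by (simp add: r_neg)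
  qed
  moreover have "c \<oplus> d = (a \<oplus> d) \<oplus> (c \<oplus> \<ominus> a)"
  proof -
    have "(a \<oplus> d) \<oplus> (c \<oplus> \<ominus> a) = (c \<oplus> d) \<oplus> (a \<oplus> \<ominus> a)" using assms by (simp add: a_ac del: r_neg)
    then show ?thesis using assms by (simp add: r_neg)
  qed
  ultimately show ?thesis using assms by simp
qed

context left_module
begin

lemma smult_r_null [simp]:
  assumes "a \<in> carrier R" shows "a \<odot>\<^bsub>M\<^esub> \<zero>\<^bsub>M\<^esub> = \<zero>\<^bsub>M\<^esub>"
proof -
  have "a \<odot>\<^bsub>M\<^esub> \<zero>\<^bsub>M\<^esub> \<oplus>\<^bsub>M\<^esub> a \<odot>\<^bsub>M\<^esub> \<zero>\<^bsub>M\<^esub> = a \<odot>\<^bsub>M\<^esub> \<zero>\<^bsub>M\<^esub>"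
    using smult_r_distr[of a "\<zero>\<^bsub>M\<^esub>" "\<zero>\<^bsub>M\<^esub>"] assms by simp
  then show ?thesis using assms by simp
qed

lemma smult_l_null [simp]:
  assumes "x \<in> carrier M" shows "\<zero> \<odot>\<^bsub>M\<^esub> x = \<zero>\<^bsub>M\<^esub>"
proof -
  have "\<zero> \<odot>\<^bsub>M\<^esub> x \<oplus>\<^bsub>M\<^esub> \<zero> \<odot>\<^bsub>M\<^esub> x = \<zero> \<odot>\<^bsub>M\<^esub> x"
    using smult_l_distr[of \<zero> \<zero> x] assms by simp
  then show ?thesis using assms by simp
qed

lemma smult_l_minus:
  assumes "a \<in> carrier R" "x \<in> carrier M" shows "(\<ominus> a) \<odot>\<^bsub>M\<^esub> x = \<ominus>\<^bsub>M\<^esub> (a \<odot>\<^bsub>M\<^esub> x)"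
proof -
  have "(\<ominus> a) \<odot>\<^bsub>M\<^esub> x \<oplus>\<^bsub>M\<^esub> a \<odot>\<^bsub>M\<^esub> x = \<zero>\<^bsub>M\<^esub>"
    using smult_l_distr[of "\<ominus> a" a x] assms by (simp add: R.l_neg)
  then show ?thesis using assms by (intro M.minus_equality[symmetric]) auto
qed

end

text \<open>Negatives come for free as left multiples by the negative of one.\<close>

lemma (in ring) left_idealI:
  assumes "I \<subseteq> carrier R" "\<zero> \<in> I" "\<And>x y. x \<in> I \<Longrightarrow> y \<in> I \<Longrightarrow> x \<oplus> y \<in> I"
    and "\<And>r x. r \<in> carrier R \<Longrightarrow> x \<in> I \<Longrightarrow> r \<otimes> x \<in> I"
  shows "left_ideal I R"
proof -
  interpret M: left_module R "regular_module R" by (rule left_module_regular_module)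
  have inv: "\<ominus>\<^bsub>regular_module R\<^esub> x \<in> I" if "x \<in> I" for x
    using M.smult_l_minus[of \<one> x] assms(4)[of "\<ominus> \<one>" x] assms(1) that by auto
  show ?thesis
    using assms inv by unfold_locales (auto simp: a_inv_def)
qed

lemma (in ring)
  assumes "left_ideal I R"
  shows left_ideal_subset: "I \<subseteq> carrier R"
    and left_ideal_zero: "\<zero> \<in> I"
    and left_ideal_add: "x \<in> I \<Longrightarrow> y \<in> I \<Longrightarrow> x \<oplus> y \<in> I"
    and left_ideal_mult: "r \<in> carrier R \<Longrightarrow> x \<in> I \<Longrightarrow> r \<otimes> x \<in> I"
    and left_ideal_a_inv: "x \<in> I \<Longrightarrow> \<ominus> x \<in> I"
    and left_ideal_minus: "x \<in> I \<Longrightarrow> y \<in> I \<Longrightarrow> x \<ominus> y \<in> I"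
proof -
  interpret I: submodule I R "regular_module R" by fact
  show sub: "I \<subseteq> carrier R" and "\<zero> \<in> I" and add: "\<And>x y. x \<in> I \<Longrightarrow> y \<in> I \<Longrightarrow> x \<oplus> y \<in> I"
    and mult: "\<And>r x. r \<in> carrier R \<Longrightarrow> x \<in> I \<Longrightarrow> r \<otimes> x \<in> I"
    using I.subset I.one_closed I.m_closed I.smult_closed by auto
  show inv: "\<ominus> x \<in> I" if "x \<in> I" for x
  proof -
    have "x \<in> carrier R" using that sub by blast
    moreover have "\<ominus> \<one> \<otimes> x \<in> I" by (rule mult) (simp_all add: that)
    ultimately show ?thesis by (simp add: l_minus)
  qed
  show "x \<in> I \<Longrightarrow> y \<in> I \<Longrightarrow> x \<ominus> y \<in> I" by (simp add: minus_eq add inv)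
qed

text \<open>Copies of left ideals inside the universe \<open>'a + 'u\<close>, as required for test modules.\<close>

definition copy_module :: "('a, 'r) ring_scheme \<Rightarrow> 'a set \<Rightarrow> ('a, 'a + 'u) module"
  where "copy_module R I =
    \<lparr>carrier = Inl ` I, mult = \<lambda>x y. Inl (projl x \<otimes>\<^bsub>R\<^esub> projl y), one = Inl \<one>\<^bsub>R\<^esub>,
     zero = Inl \<zero>\<^bsub>R\<^esub>, add = \<lambda>x y. Inl (projl x \<oplus>\<^bsub>R\<^esub> projl y),
     smult = \<lambda>a x. Inl (a \<otimes>\<^bsub>R\<^esub> projl x)\<rparr>"

lemma copy_module_simps [simp]:
  "carrier (copy_module R I) = Inl ` I"
  "zero (copy_module R I) = Inl \<zero>\<^bsub>R\<^esub>"
  "x \<oplus>\<^bsub>copy_module R I\<^esub> y = Inl (projl x \<oplus>\<^bsub>R\<^esub> projl y)"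
  "a \<odot>\<^bsub>copy_module R I\<^esub> x = Inl (a \<otimes>\<^bsub>R\<^esub> projl x)"
  by (simp_all add: copy_module_def)

lemma (in ring) left_module_copy_module:
  assumes "left_ideal I R"
  shows "left_module R (copy_module R I :: ('a, 'a + 'u) module)"
proof -
  note I = left_ideal_zero[OF assms] left_ideal_add[OF assms] left_ideal_mult[OF assms]
    left_ideal_a_inv[OF assms]
  have sub [simp]: "x \<in> I \<Longrightarrow> x \<in> carrier R" for x using left_ideal_subset[OF assms] by auto
  have "abelian_group (copy_module R I :: ('a, 'a + 'u) module)"
  proof (rule abelian_groupI)
    fix x assume "x \<in> carrier (copy_module R I :: ('a, 'a + 'u) module)"
    then obtain y where "x = Inl y" "y \<in> I" by auto
    then show "\<exists>y\<in>carrier (copy_module R I). y \<oplus>\<^bsub>copy_module R I\<^esub> x = \<zero>\<^bsub>copy_module R I\<^esub>"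
      by (intro bexI[of _ "Inl (\<ominus> y)"]) (auto simp: I l_neg)
  qed (auto simp: I a_ac)
  then show ?thesis
    by (auto simp: left_module_def left_module_axioms_def l_distr r_distr m_assoc I ring_axioms)
qed

text \<open>The element \<open>e\<close> is the image of one under an extension of \<open>f\<close>
  to the whole ring. No test modules are quantified over, so the condition is independent of any
  universe.\<close>

definition baer_condition :: "('a, 'r) ring_scheme \<Rightarrow> ('a, 'e, 'x) module_scheme \<Rightarrow> bool"
  where "baer_condition R E \<longleftrightarrow>
    (\<forall>I f. left_ideal I R \<and> f \<in> left_module_hom R ((regular_module R)\<lparr>carrier := I\<rparr>) E \<longrightarrow>
      (\<exists>e\<in>carrier E. \<forall>x\<in>I. f x = x \<odot>\<^bsub>E\<^esub> e))"

lemma left_module_hom_ideal_iff: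
  "f \<in> left_module_hom R ((regular_module R)\<lparr>carrier := I\<rparr>) E \<longleftrightarrow>
    f \<in> I \<rightarrow> carrier E \<and> (\<forall>x\<in>I. \<forall>y\<in>I. f (x \<oplus>\<^bsub>R\<^esub> y) = f x \<oplus>\<^bsub>E\<^esub> f y) \<and>
    (\<forall>a\<in>carrier R. \<forall>x\<in>I. f (a \<otimes>\<^bsub>R\<^esub> x) = a \<odot>\<^bsub>E\<^esub> f x)"
  by (simp add: left_module_hom_def)

lemma (in ring) left_ideal_carrier: "left_ideal (carrier R) R"
  by (rule left_idealI) auto

text \<open>The inclusion of \<open>I\<close> into the ring is realised between copies in the left
  summand of \<open>'a + 'u\<close>; extending \<open>f\<close> along it and evaluating at the copy
  of one yields \<open>e\<close>.\<close>

lemma injective_imp_baer_condition: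
  fixes R :: "('a, 'r) ring_scheme"
  assumes "ring R" "injective_module TYPE('a + 'u) R E"
  shows "baer_condition R E"
  unfolding baer_condition_def
proof (intro allI impI, elim conjE)
  fix I f assume I: "left_ideal I R" and f: "f \<in> left_module_hom R ((regular_module R)\<lparr>carrier := I\<rparr>) E"
  interpret ring R by fact
  let ?N = "copy_module R I :: ('a, 'a + 'u) module"
  let ?M = "copy_module R (carrier R) :: ('a, 'a + 'u) module"
  have "left_module R ?N" "left_module R ?M"
    by (intro left_module_copy_module I left_ideal_carrier)+
  moreover have "id \<in> left_module_hom R ?N ?M" "inj_on id (carrier ?N)"
    using left_ideal_subset[OF I] by (auto simp: left_module_hom_def)
  moreover have "f \<circ> projl \<in> left_module_hom R ?N E"
    using f by (auto simp: left_module_hom_def)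
  ultimately obtain h where h: "h \<in> left_module_hom R ?M E" "\<forall>x\<in>carrier ?N. h (id x) = (f \<circ> projl) x"
    using assms(2) unfolding injective_module_def by blast
  have "f x = x \<odot>\<^bsub>E\<^esub> h (Inl \<one>\<^bsub>R\<^esub>)" if "x \<in> I" for x
  proof -
    have "h (x \<odot>\<^bsub>?M\<^esub> Inl \<one>\<^bsub>R\<^esub>) = x \<odot>\<^bsub>E\<^esub> h (Inl \<one>\<^bsub>R\<^esub>)"
      using h(1) that left_ideal_subset[OF I] unfolding left_module_hom_def by fastforce
    then show ?thesis using h(2) that left_ideal_subset[OF I] by (auto simp: subset_iff)
  qed
  moreover have "h (Inl \<one>\<^bsub>R\<^esub>) \<in> carrier E" using h(1) by (auto simp: left_module_hom_def)
  ultimately show "\<exists>e\<in>carrier E. \<forall>x\<in>I. f x = x \<odot>\<^bsub>E\<^esub> e" by blast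
qed

text \<open>Partial homomorphisms \<open>M \<rightarrow> E\<close> are represented by their graphs, so that Zorn's lemma for
  inclusion applies.\<close>

definition hom_graph ::
  "('a, 'r) ring_scheme \<Rightarrow> ('a, 'm, 'x) module_scheme \<Rightarrow> ('a, 'e, 'y) module_scheme \<Rightarrow> ('m \<times> 'e) set \<Rightarrow> bool"
  where "hom_graph R M E P \<longleftrightarrow> P \<subseteq> carrier M \<times> carrier E \<and>
    (\<forall>x y x' y'. (x, y) \<in> P \<longrightarrow> (x', y') \<in> P \<longrightarrow> (x \<oplus>\<^bsub>M\<^esub> x', y \<oplus>\<^bsub>E\<^esub> y') \<in> P) \<and>
    (\<forall>a\<in>carrier R. \<forall>x y. (x, y) \<in> P \<longrightarrow> (a \<odot>\<^bsub>M\<^esub> x, a \<odot>\<^bsub>E\<^esub> y) \<in> P) \<and>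
    (\<forall>x y y'. (x, y) \<in> P \<longrightarrow> (x, y') \<in> P \<longrightarrow> y = y')"

text \<open>A partial homomorphism is extended to one more element \<open>x0\<close>. Baer's
  condition finds a value for \<open>x0\<close> that is compatible with the values already
  prescribed on the multiples of \<open>x0\<close>.\<close>

lemma hom_graph_extend:
  assumes "left_module R M" "left_module R E" and baer: "baer_condition R E"
    and P: "hom_graph R M E P" "P \<noteq> {}" and x0: "x0 \<in> carrier M"
  shows "\<exists>Q e. hom_graph R M E Q \<and> P \<subseteq> Q \<and> (x0, e) \<in> Q"
proof -
  interpret M: left_module R M by fact
  interpret E: left_module R E by fact
  have PC: "x \<in> carrier M" "y \<in> carrier E" if "(x, y) \<in> P" for x y
    using P that by (auto simp: hom_graph_def)
  have Padd: "(x \<oplus>\<^bsub>M\<^esub> x', y \<oplus>\<^bsub>E\<^esub> y') \<in> P" if "(x, y) \<in> P" "(x', y') \<in> P" for x y x' y'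
    using P that by (auto simp: hom_graph_def)
  have Psmult: "(a \<odot>\<^bsub>M\<^esub> x, a \<odot>\<^bsub>E\<^esub> y) \<in> P" if "(x, y) \<in> P" "a \<in> carrier R" for a x y
    using P that by (auto simp: hom_graph_def)
  have Puniq: "y = y'" if "(x, y) \<in> P" "(x, y') \<in> P" for x y y'
    using P that unfolding hom_graph_def by blast
  have P0: "(\<zero>\<^bsub>M\<^esub>, \<zero>\<^bsub>E\<^esub>) \<in> P"
  proof -
    obtain x y where "(x, y) \<in> P" using P(2) by auto
    then show ?thesis using Psmult[of x y "\<zero>\<^bsub>R\<^esub>"] PC by simp
  qed
  have Pinv: "(\<ominus>\<^bsub>M\<^esub> x, \<ominus>\<^bsub>E\<^esub> y) \<in> P" if "(x, y) \<in> P" for x y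
    using Psmult[of x y "\<ominus>\<^bsub>R\<^esub> \<one>\<^bsub>R\<^esub>"] PC that by (simp add: M.smult_l_minus E.smult_l_minus)
  \<comment> \<open>\<open>I\<close> collects the scalars that carry \<open>x0\<close> into the
    domain of \<open>P\<close>, and \<open>f r\<close> below is the value that \<open>P\<close>
    prescribes at that multiple.\<close>
  define I where "I = {r \<in> carrier R. \<exists>e. (r \<odot>\<^bsub>M\<^esub> x0, e) \<in> P}"
  define f where "f = (\<lambda>r. THE e. (r \<odot>\<^bsub>M\<^esub> x0, e) \<in> P)"
  have f: "f r = e" if "(r \<odot>\<^bsub>M\<^esub> x0, e) \<in> P" for r e
    unfolding f_def using that Puniq by blast
  have fI: "(r \<odot>\<^bsub>M\<^esub> x0, f r) \<in> P" "r \<in> carrier R" if "r \<in> I" for r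
    using that f unfolding I_def by blast+
  have add: "((r \<oplus>\<^bsub>R\<^esub> s) \<odot>\<^bsub>M\<^esub> x0, f r \<oplus>\<^bsub>E\<^esub> f s) \<in> P" if "r \<in> I" "s \<in> I" for r s
    using Padd[OF fI(1)[OF that(1)] fI(1)[OF that(2)]] fI that x0 by (simp add: M.smult_l_distr)
  have mult: "((a \<otimes>\<^bsub>R\<^esub> r) \<odot>\<^bsub>M\<^esub> x0, a \<odot>\<^bsub>E\<^esub> f r) \<in> P" if "a \<in> carrier R" "r \<in> I" for a r
    using Psmult[OF fI(1)[OF that(2)] that(1)] fI that x0 by (simp add: M.smult_assoc1)
  have "left_ideal I R"
  proof (rule M.R.left_idealI)
    have II: "r \<in> I" if "(r \<odot>\<^bsub>M\<^esub> x0, e) \<in> P" "r \<in> carrier R" for r e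
      using that unfolding I_def by blast
    show "\<zero>\<^bsub>R\<^esub> \<in> I" using P0 x0 by (intro II[of _ "\<zero>\<^bsub>E\<^esub>"]) auto
    show "x \<oplus>\<^bsub>R\<^esub> y \<in> I" if "x \<in> I" "y \<in> I" for x y
      using fI that by (intro II[OF add[OF that]]) auto
    show "r \<otimes>\<^bsub>R\<^esub> x \<in> I" if "r \<in> carrier R" "x \<in> I" for r x
      using fI that by (intro II[OF mult[OF that]]) auto
  qed (auto simp: I_def)
  moreover have "f \<in> left_module_hom R ((regular_module R)\<lparr>carrier := I\<rparr>) E"
    unfolding left_module_hom_ideal_iff using PC(2)[OF fI(1)] f[OF add] f[OF mult] by auto
  ultimately obtain e0 where e0: "e0 \<in> carrier E" "\<And>r. r \<in> I \<Longrightarrow> f r = r \<odot>\<^bsub>E\<^esub> e0"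
    using baer unfolding baer_condition_def by blast
  \<comment> \<open>The sum of \<open>P\<close> and the multiples of the pair
    \<open>(x0, e0)\<close>.\<close>
  define Q where "Q = {(x \<oplus>\<^bsub>M\<^esub> r \<odot>\<^bsub>M\<^esub> x0, y \<oplus>\<^bsub>E\<^esub> r \<odot>\<^bsub>E\<^esub> e0) | x y r. (x, y) \<in> P \<and> r \<in> carrier R}"
  have QI: "(x \<oplus>\<^bsub>M\<^esub> r \<odot>\<^bsub>M\<^esub> x0, y \<oplus>\<^bsub>E\<^esub> r \<odot>\<^bsub>E\<^esub> e0) \<in> Q" if "(x, y) \<in> P" "r \<in> carrier R" for x y r
    using that Q_def by blast
  have "hom_graph R M E Q"
    unfolding hom_graph_def
  proof (intro conjI allI impI ballI subsetI)
    show "p \<in> carrier M \<times> carrier E" if "p \<in> Q" for p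
      using that x0 e0 PC by (auto simp: Q_def)
  next
    fix x y x' y' assume "(x, y) \<in> Q" "(x', y') \<in> Q"
    then obtain u v r u' v' r' where
      eq: "x = u \<oplus>\<^bsub>M\<^esub> r \<odot>\<^bsub>M\<^esub> x0" "y = v \<oplus>\<^bsub>E\<^esub> r \<odot>\<^bsub>E\<^esub> e0" "(u, v) \<in> P" "r \<in> carrier R"
        "x' = u' \<oplus>\<^bsub>M\<^esub> r' \<odot>\<^bsub>M\<^esub> x0" "y' = v' \<oplus>\<^bsub>E\<^esub> r' \<odot>\<^bsub>E\<^esub> e0" "(u', v') \<in> P" "r' \<in> carrier R"
      unfolding Q_def by blast
    have "x \<oplus>\<^bsub>M\<^esub> x' = (u \<oplus>\<^bsub>M\<^esub> u') \<oplus>\<^bsub>M\<^esub> (r \<oplus>\<^bsub>R\<^esub> r') \<odot>\<^bsub>M\<^esub> x0"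
      "y \<oplus>\<^bsub>E\<^esub> y' = (v \<oplus>\<^bsub>E\<^esub> v') \<oplus>\<^bsub>E\<^esub> (r \<oplus>\<^bsub>R\<^esub> r') \<odot>\<^bsub>E\<^esub> e0"
      using eq PC x0 e0 by (simp_all add: M.smult_l_distr E.smult_l_distr M.M.a_ac E.M.a_ac)
    then show "(x \<oplus>\<^bsub>M\<^esub> x', y \<oplus>\<^bsub>E\<^esub> y') \<in> Q"
      using QI[OF Padd[OF eq(3,7)], of "r \<oplus>\<^bsub>R\<^esub> r'"] eq by simp
  next
    fix a x y assume a: "a \<in> carrier R" and "(x, y) \<in> Q"
    then obtain u v r where
      eq: "x = u \<oplus>\<^bsub>M\<^esub> r \<odot>\<^bsub>M\<^esub> x0" "y = v \<oplus>\<^bsub>E\<^esub> r \<odot>\<^bsub>E\<^esub> e0" "(u, v) \<in> P" "r \<in> carrier R"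
      unfolding Q_def by blast
    have "a \<odot>\<^bsub>M\<^esub> x = a \<odot>\<^bsub>M\<^esub> u \<oplus>\<^bsub>M\<^esub> (a \<otimes>\<^bsub>R\<^esub> r) \<odot>\<^bsub>M\<^esub> x0"
      "a \<odot>\<^bsub>E\<^esub> y = a \<odot>\<^bsub>E\<^esub> v \<oplus>\<^bsub>E\<^esub> (a \<otimes>\<^bsub>R\<^esub> r) \<odot>\<^bsub>E\<^esub> e0"
      using eq PC x0 e0 a
      by (simp_all add: M.smult_r_distr E.smult_r_distr M.smult_assoc1 E.smult_assoc1)
    then show "(a \<odot>\<^bsub>M\<^esub> x, a \<odot>\<^bsub>E\<^esub> y) \<in> Q"
      using QI[OF Psmult[OF eq(3) a], of "a \<otimes>\<^bsub>R\<^esub> r"] eq a by simp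
  next
    fix x y y' assume "(x, y) \<in> Q" "(x, y') \<in> Q"
    then obtain u v r u' v' r' where
      eq: "x = u \<oplus>\<^bsub>M\<^esub> r \<odot>\<^bsub>M\<^esub> x0" "y = v \<oplus>\<^bsub>E\<^esub> r \<odot>\<^bsub>E\<^esub> e0" "(u, v) \<in> P" "r \<in> carrier R"
        "x = u' \<oplus>\<^bsub>M\<^esub> r' \<odot>\<^bsub>M\<^esub> x0" "y' = v' \<oplus>\<^bsub>E\<^esub> r' \<odot>\<^bsub>E\<^esub> e0" "(u', v') \<in> P" "r' \<in> carrier R"
      unfolding Q_def by blast
    have C: "u \<in> carrier M" "u' \<in> carrier M" "v \<in> carrier E" "v' \<in> carrier E"
      using PC eq by auto
    have D: "r \<odot>\<^bsub>M\<^esub> x0 \<in> carrier M" "r' \<odot>\<^bsub>M\<^esub> x0 \<in> carrier M" "r \<odot>\<^bsub>E\<^esub> e0 \<in> carrier E" "r' \<odot>\<^bsub>E\<^esub> e0 \<in> carrier E"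
      using eq x0 e0 by auto
    \<comment> \<open>Two representations of \<open>x\<close> differ by the multiple
      \<open>s\<close> of \<open>x0\<close>, which equals \<open>u' - u\<close> and so lies in the
      domain of \<open>P\<close>. Hence \<open>s\<close> is in \<open>I\<close>, and
      \<open>e0\<close> was chosen so that \<open>s\<close> times \<open>e0\<close> is the
      prescribed value \<open>v' - v\<close>.\<close>
    define s where "s = r \<oplus>\<^bsub>R\<^esub> \<ominus>\<^bsub>R\<^esub> r'"
    have s: "s \<in> carrier R" using eq by (simp add: s_def)
    have sM: "s \<odot>\<^bsub>M\<^esub> x0 = r \<odot>\<^bsub>M\<^esub> x0 \<oplus>\<^bsub>M\<^esub> \<ominus>\<^bsub>M\<^esub> (r' \<odot>\<^bsub>M\<^esub> x0)"
      and sE: "s \<odot>\<^bsub>E\<^esub> e0 = r \<odot>\<^bsub>E\<^esub> e0 \<oplus>\<^bsub>E\<^esub> \<ominus>\<^bsub>E\<^esub> (r' \<odot>\<^bsub>E\<^esub> e0)"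
      using eq x0 e0 by (simp_all add: s_def M.smult_l_distr E.smult_l_distr M.smult_l_minus E.smult_l_minus)
    have "u \<oplus>\<^bsub>M\<^esub> r \<odot>\<^bsub>M\<^esub> x0 = u' \<oplus>\<^bsub>M\<^esub> r' \<odot>\<^bsub>M\<^esub> x0" using eq by simp
    then have "s \<odot>\<^bsub>M\<^esub> x0 = u' \<oplus>\<^bsub>M\<^esub> \<ominus>\<^bsub>M\<^esub> u"
      unfolding sM by (rule iffD1[OF M.M.add_eq_add_iff[OF C(1) D(1) C(2) D(2)]])
    then have sP: "(s \<odot>\<^bsub>M\<^esub> x0, v' \<oplus>\<^bsub>E\<^esub> \<ominus>\<^bsub>E\<^esub> v) \<in> P"
      using Padd[OF eq(7) Pinv[OF eq(3)]] by simp
    then have "s \<in> I" using s by (auto simp: I_def)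
    then have "s \<odot>\<^bsub>E\<^esub> e0 = v' \<oplus>\<^bsub>E\<^esub> \<ominus>\<^bsub>E\<^esub> v" using e0 f[OF sP] by simp
    then have "r \<odot>\<^bsub>E\<^esub> e0 \<oplus>\<^bsub>E\<^esub> \<ominus>\<^bsub>E\<^esub> (r' \<odot>\<^bsub>E\<^esub> e0) = v' \<oplus>\<^bsub>E\<^esub> \<ominus>\<^bsub>E\<^esub> v" by (simp add: sE)
    then have "v \<oplus>\<^bsub>E\<^esub> r \<odot>\<^bsub>E\<^esub> e0 = v' \<oplus>\<^bsub>E\<^esub> r' \<odot>\<^bsub>E\<^esub> e0"
      by (rule iffD2[OF E.M.add_eq_add_iff[OF C(3) D(3) C(4) D(4)]])
    then show "y = y'" using eq by simp
  qed
  moreover have "P \<subseteq> Q"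
  proof safe
    fix x y assume "(x, y) \<in> P"
    then show "(x, y) \<in> Q" using QI[of x y "\<zero>\<^bsub>R\<^esub>"] PC x0 e0 by simp
  qed
  moreover have "(x0, e0) \<in> Q" using QI[OF P0, of "\<one>\<^bsub>R\<^esub>"] x0 e0 by simp
  ultimately show ?thesis by blast
qed

text \<open>Zorn's lemma gives a maximal partial homomorphism from \<open>M\<close> to
  \<open>E\<close> extending \<open>f\<close> along \<open>i\<close>; by
  \<open>hom_graph_extend\<close> its domain is all of \<open>M\<close>. The universe
  \<open>'u\<close> is arbitrary.\<close>

lemma baer_criterion:
  assumes "left_module R E" "baer_condition R E"
  shows "injective_module TYPE('u) R E"
  unfolding injective_module_def
proof (intro conjI allI impI, fact, elim conjE)
  fix N M :: "('a, 'u) module" and i f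
  assume NM: "left_module R N" "left_module R M"
    and i: "i \<in> left_module_hom R N M" "inj_on i (carrier N)" and f: "f \<in> left_module_hom R N E"
  interpret N: left_module R N by fact
  interpret M: left_module R M by fact
  interpret E: left_module R E by fact
  \<comment> \<open>The graph of \<open>f\<close> after the inverse of \<open>i\<close>, on the
    image of \<open>i\<close>; injectivity of \<open>i\<close> makes it single-valued.\<close>
  define P0 where "P0 = (\<lambda>x. (i x, f x)) ` carrier N"
  have closed: "i x \<in> carrier M" "f x \<in> carrier E" if "x \<in> carrier N" for x
    using i f that by (auto simp: left_module_hom_def)
  have hom: "i (x \<oplus>\<^bsub>N\<^esub> y) = i x \<oplus>\<^bsub>M\<^esub> i y" "f (x \<oplus>\<^bsub>N\<^esub> y) = f x \<oplus>\<^bsub>E\<^esub> f y"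
      "a \<in> carrier R \<Longrightarrow> i (a \<odot>\<^bsub>N\<^esub> x) = a \<odot>\<^bsub>M\<^esub> i x" "a \<in> carrier R \<Longrightarrow> f (a \<odot>\<^bsub>N\<^esub> x) = a \<odot>\<^bsub>E\<^esub> f x"
    if "x \<in> carrier N" "y \<in> carrier N" for x y a
    using i f that by (auto simp: left_module_hom_def)
  have P0: "hom_graph R M E P0"
    unfolding hom_graph_def
  proof (intro conjI allI impI ballI)
    show "P0 \<subseteq> carrier M \<times> carrier E" using closed by (auto simp: P0_def)
  next
    fix x y x' y' assume "(x, y) \<in> P0" "(x', y') \<in> P0"
    then obtain n n' where "n \<in> carrier N" "n' \<in> carrier N" "x = i n" "y = f n" "x' = i n'" "y' = f n'"
      by (auto simp: P0_def)
    then show "(x \<oplus>\<^bsub>M\<^esub> x', y \<oplus>\<^bsub>E\<^esub> y') \<in> P0"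
      unfolding P0_def by (intro image_eqI[of _ _ "n \<oplus>\<^bsub>N\<^esub> n'"]) (auto simp: hom)
  next
    fix a x y assume "a \<in> carrier R" "(x, y) \<in> P0"
    then obtain n where "n \<in> carrier N" "x = i n" "y = f n"
      by (auto simp: P0_def)
    then show "(a \<odot>\<^bsub>M\<^esub> x, a \<odot>\<^bsub>E\<^esub> y) \<in> P0"
      unfolding P0_def using \<open>a \<in> carrier R\<close>
      by (intro image_eqI[of _ _ "a \<odot>\<^bsub>N\<^esub> n"]) (auto simp: hom)
  next
    show "y = y'" if "(x, y) \<in> P0" "(x, y') \<in> P0" for x y y'
      using that i(2) by (auto simp: P0_def dest: inj_onD)
  qed
  have "\<exists>P\<in>{P. hom_graph R M E P \<and> P0 \<subseteq> P}. \<forall>X\<in>{P. hom_graph R M E P \<and> P0 \<subseteq> P}. P \<subseteq> X \<longrightarrow> X = P"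
  proof (rule subset_Zorn_nonempty)
    show "{P. hom_graph R M E P \<and> P0 \<subseteq> P} \<noteq> {}" using P0 by auto
    fix C assume "C \<noteq> {}" and "subset.chain {P. hom_graph R M E P \<and> P0 \<subseteq> P} C"
    then have C: "\<And>P. P \<in> C \<Longrightarrow> hom_graph R M E P" "\<And>P. P \<in> C \<Longrightarrow> P0 \<subseteq> P"
      and chain: "\<And>P Q. P \<in> C \<Longrightarrow> Q \<in> C \<Longrightarrow> P \<subseteq> Q \<or> Q \<subseteq> P"
      by (auto simp: subset_chain_def)
    \<comment> \<open>Any two pairs of the union lie in a common member of the chain, so conditions
      on two pairs pass to the union.\<close>
    have two: "\<exists>P\<in>C. p \<in> P \<and> q \<in> P" if "p \<in> \<Union>C" "q \<in> \<Union>C" for p q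
      using that chain by (meson UnionE subsetD)
    have "hom_graph R M E (\<Union>C)"
      unfolding hom_graph_def
    proof (intro conjI allI impI ballI)
      show "\<Union>C \<subseteq> carrier M \<times> carrier E" using C(1) unfolding hom_graph_def by blast
      show "(x \<oplus>\<^bsub>M\<^esub> x', y \<oplus>\<^bsub>E\<^esub> y') \<in> \<Union>C" if "(x, y) \<in> \<Union>C" "(x', y') \<in> \<Union>C" for x y x' y'
        using two[OF that] C(1) unfolding hom_graph_def by blast
      show "(a \<odot>\<^bsub>M\<^esub> x, a \<odot>\<^bsub>E\<^esub> y) \<in> \<Union>C" if "a \<in> carrier R" "(x, y) \<in> \<Union>C" for a x y
        using that C(1) unfolding hom_graph_def by blast
      show "y = y'" if "(x, y) \<in> \<Union>C" "(x, y') \<in> \<Union>C" for x y y'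
        using two[OF that] C(1) unfolding hom_graph_def by blast
    qed
    with \<open>C \<noteq> {}\<close> C(2) show "\<Union>C \<in> {P. hom_graph R M E P \<and> P0 \<subseteq> P}" by blast
  qed
  then obtain P where "P \<in> {P. hom_graph R M E P \<and> P0 \<subseteq> P}"
    and maximal: "\<forall>X\<in>{P. hom_graph R M E P \<and> P0 \<subseteq> P}. P \<subseteq> X \<longrightarrow> X = P" by (rule bexE)
  then have P: "hom_graph R M E P" "P0 \<subseteq> P" by simp_all
  have max: "X = P" if "hom_graph R M E X" "P \<subseteq> X" for X
    using maximal that P(2) by simp
  have "P \<noteq> {}" using P(2) N.M.zero_closed unfolding P0_def by blast
  then have total: "\<exists>y. (x, y) \<in> P" if "x \<in> carrier M" for x
    using hom_graph_extend[OF NM(2) assms P(1) _ that] max by metis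
  define h where "h x = (THE y. (x, y) \<in> P)" for x
  have uniq: "y = y'" if "(x, y) \<in> P" "(x, y') \<in> P" for x y y'
    using P(1) that unfolding hom_graph_def by blast
  have h: "h x = y" if "(x, y) \<in> P" for x y
    unfolding h_def using that uniq by blast
  have hP: "(x, h x) \<in> P" if "x \<in> carrier M" for x using total[OF that] h by auto
  have "h \<in> left_module_hom R M E"
    unfolding left_module_hom_def
  proof (intro CollectI conjI ballI funcsetI)
    show "h x \<in> carrier E" if "x \<in> carrier M" for x
      using hP[OF that] P(1) unfolding hom_graph_def by blast
    show "h (x \<oplus>\<^bsub>M\<^esub> y) = h x \<oplus>\<^bsub>E\<^esub> h y" if "x \<in> carrier M" "y \<in> carrier M" for x y
      using hP[OF that(1)] hP[OF that(2)] P(1) unfolding hom_graph_def by (intro h) blast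
    show "h (a \<odot>\<^bsub>M\<^esub> x) = a \<odot>\<^bsub>E\<^esub> h x" if "a \<in> carrier R" "x \<in> carrier M" for a x
      using hP[OF that(2)] that(1) P(1) unfolding hom_graph_def by (intro h) blast
  qed
  moreover have "h (i x) = f x" if "x \<in> carrier N" for x
    using P(2) that by (intro h) (auto simp: P0_def)
  ultimately show "\<exists>h\<in>left_module_hom R M E. \<forall>x\<in>carrier N. h (i x) = f x" by blast
qed

section \<open>Graded rings of finite support\<close>

locale finite_support_graded_ring =
  G: group G + ring R + direct_sum R "carrier G" Rgr
  for G :: "('g, 'b) monoid_scheme" and R :: "('a, 'r) ring_scheme" (structure) and Rgr +
  assumes graded_mult:
      "\<lbrakk>g \<in> carrier G; h \<in> carrier G; a \<in> Rgr g; b \<in> Rgr h\<rbrakk> \<Longrightarrow> a \<otimes> b \<in> Rgr (g \<otimes>\<^bsub>G\<^esub> h)"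
    and finite_support: "finite {g \<in> carrier G. Rgr g \<noteq> {\<zero>}}"
begin

section \<open>Components of products with a homogeneous factor\<close>

lemma G_cancel [simp]:
  assumes "g \<in> carrier G" "h \<in> carrier G"
  shows "g \<otimes>\<^bsub>G\<^esub> (inv\<^bsub>G\<^esub> g \<otimes>\<^bsub>G\<^esub> h) = h" "inv\<^bsub>G\<^esub> g \<otimes>\<^bsub>G\<^esub> (g \<otimes>\<^bsub>G\<^esub> h) = h"
    "g \<otimes>\<^bsub>G\<^esub> h \<otimes>\<^bsub>G\<^esub> inv\<^bsub>G\<^esub> h = g" "g \<otimes>\<^bsub>G\<^esub> inv\<^bsub>G\<^esub> h \<otimes>\<^bsub>G\<^esub> h = g"
  using assms by (simp_all add: G.m_assoc[symmetric]) (simp_all add: G.m_assoc)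

text \<open>A left factor of degree \<open>s\<close> shifts degrees by \<open>s\<close> from the
  left; in \<open>proj_mult_right\<close> a right factor shifts them from the right. The two shifts
  commute, which is what makes windows compatible with left multiplication.\<close>

lemma proj_mult_left:
  assumes "r \<in> Rgr s" "s \<in> carrier G" "g \<in> carrier G" "x \<in> carrier R"
  shows "proj g (r \<otimes> x) = r \<otimes> proj (inv\<^bsub>G\<^esub> s \<otimes>\<^bsub>G\<^esub> g) x"
  using \<open>x \<in> carrier R\<close>
proof (induction rule: homogeneous_induct)
  case zero
  then show ?case using assms by simp
next
  case (homogeneous k x)
  have "proj g (r \<otimes> x) = (if g = s \<otimes>\<^bsub>G\<^esub> k then r \<otimes> x else \<zero>)"
    using assms homogeneous graded_mult by (intro proj_of_homogeneous) auto
  also have "\<dots> = r \<otimes> (if inv\<^bsub>G\<^esub> s \<otimes>\<^bsub>G\<^esub> g = k then x else \<zero>)"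
    using assms homogeneous by auto
  also have "\<dots> = r \<otimes> proj (inv\<^bsub>G\<^esub> s \<otimes>\<^bsub>G\<^esub> g) x"
    using assms homogeneous by (subst proj_of_homogeneous[of x k]) auto
  finally show ?case .
next
  case (add x y)
  then show ?case using assms by (simp add: r_distr)
qed

lemma proj_mult_right:
  assumes "b \<in> Rgr h" "h \<in> carrier G" "g \<in> carrier G" "x \<in> carrier R"
  shows "proj g (x \<otimes> b) = proj (g \<otimes>\<^bsub>G\<^esub> inv\<^bsub>G\<^esub> h) x \<otimes> b"
  using \<open>x \<in> carrier R\<close>
proof (induction rule: homogeneous_induct)
  case zero
  then show ?case using assms by simp
next
  case (homogeneous k x)
  have "proj g (x \<otimes> b) = (if g = k \<otimes>\<^bsub>G\<^esub> h then x \<otimes> b else \<zero>)"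
    using assms homogeneous graded_mult by (intro proj_of_homogeneous) auto
  also have "\<dots> = (if g \<otimes>\<^bsub>G\<^esub> inv\<^bsub>G\<^esub> h = k then x else \<zero>) \<otimes> b"
    using assms homogeneous by auto
  also have "\<dots> = proj (g \<otimes>\<^bsub>G\<^esub> inv\<^bsub>G\<^esub> h) x \<otimes> b"
    using assms homogeneous by (subst proj_of_homogeneous[of x k]) auto
  finally show ?case .
next
  case (add x y)
  then show ?case using assms by (simp add: l_distr)
qed

text \<open>The component of one in the neutral degree is a right identity: for \<open>x\<close> of
  degree \<open>g\<close> this is read off the degree \<open>g\<close> part of
  \<open>x \<otimes> \<one>\<close>. Applied to one, it shows that one equals this
  component.\<close>

lemma one_homogeneous: "\<one> \<in> Rgr \<one>\<^bsub>G\<^esub>"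
proof -
  have "x \<otimes> proj \<one>\<^bsub>G\<^esub> \<one> = x" if "x \<in> carrier R" for x
    using that
  proof (induction rule: homogeneous_induct)
    case (homogeneous g x)
    then show ?case using proj_mult_left[of x g g \<one>] by simp
  qed (simp_all add: l_distr)
  from this[of \<one>] show ?thesis using proj_homogeneous[of \<one> "\<one>\<^bsub>G\<^esub>"] by simp
qed

text \<open>Finite support enters here: \<open>d\<close> vanishes outside a fixed finite set of
  degrees, so it can be summed even if the group is infinite. Components can thus be prescribed
  independently in every degree.\<close>

lemma ex_proj_eq:
  assumes "\<And>g. g \<in> carrier G \<Longrightarrow> d g \<in> Rgr g"
  shows "\<exists>y\<in>carrier R. \<forall>g\<in>carrier G. proj g y = d g"
proof
  let ?S = "{g \<in> carrier G. Rgr g \<noteq> {\<zero>}}"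
  show "finsum R d ?S \<in> carrier R" by (intro finsum_closed) (auto intro: homogeneous_closed[OF assms])
  show "\<forall>g\<in>carrier G. proj g (finsum R d ?S) = d g"
  proof
    fix g assume g: "g \<in> carrier G"
    show "proj g (finsum R d ?S) = d g"
      using proj_finsum[OF finite_support _ _ g, of d] assms[OF g] assms g by (cases "Rgr g = {\<zero>}") auto
  qed
qed

section \<open>Windows of a left ideal\<close>

text \<open>For \<open>b\<close> of degree \<open>k\<close>, the degree \<open>g\<close> part of
  \<open>x \<otimes> b\<close> is \<open>x\<^sub>t \<otimes> b\<close> with
  \<open>t = g k\<inverse>\<close>. For \<open>x\<close> in the window, the degree \<open>g\<close>
  part of a product \<open>x \<otimes> a\<close> therefore depends only on the components of
  \<open>a\<close> with degree in \<open>K\<close>.\<close>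

definition window :: "'a set \<Rightarrow> 'g set \<Rightarrow> 'g \<Rightarrow> 'a set"
  where "window I K g = {x\<in>I. \<forall>k\<in>carrier G - K. proj (g \<otimes>\<^bsub>G\<^esub> inv\<^bsub>G\<^esub> k) x = \<zero>}"

text \<open>With \<open>h\<close> fixed, \<open>g h\<inverse>\<close> runs once through all degrees,
  so each component of \<open>r\<close> is tested against its own window. Different components may
  have unrelated witnesses \<open>x\<close>, which makes the set closed under taking
  components.\<close>

definition window_ideal :: "'a set \<Rightarrow> 'g set \<Rightarrow> 'g \<Rightarrow> 'a set"
  where "window_ideal I K h = {r\<in>carrier R. \<forall>g\<in>carrier G. \<exists>x\<in>window I K g.
    proj (g \<otimes>\<^bsub>G\<^esub> inv\<^bsub>G\<^esub> h) x = proj (g \<otimes>\<^bsub>G\<^esub> inv\<^bsub>G\<^esub> h) r}"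

context
  fixes I assumes I: "left_ideal I R"
begin

lemma window_subset: "x \<in> window I K g \<Longrightarrow> x \<in> I"
  by (simp add: window_def)

lemma window_closed: "x \<in> window I K g \<Longrightarrow> x \<in> carrier R"
  using left_ideal_subset[OF I] by (auto simp: window_def)

lemma window_zero: "g \<in> carrier G \<Longrightarrow> \<zero> \<in> window I K g"
  using left_ideal_zero[OF I] by (simp add: window_def)

lemma window_add:
  assumes "x \<in> window I K g" "y \<in> window I K g" "g \<in> carrier G"
  shows "x \<oplus> y \<in> window I K g"
  using assms left_ideal_add[OF I] window_closed[OF assms(1)] window_closed[OF assms(2)]
  by (simp add: window_def)

lemma window_minus:
  assumes "x \<in> window I K g" "y \<in> window I K g" "g \<in> carrier G"
  shows "x \<ominus> y \<in> window I K g"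
  using assms left_ideal_minus[OF I] window_closed[OF assms(1)] window_closed[OF assms(2)]
  by (simp add: window_def minus_eq[of \<zero> \<zero>])

text \<open>The difference loses exactly the component belonging to \<open>h\<close>; this is how
  the inductions over \<open>T\<close> descend to the smaller window.\<close>

lemma window_minus_cancel:
  assumes "x \<in> window I (insert h T) g" "y \<in> window I (insert h T) g" "g \<in> carrier G" "h \<in> carrier G"
    and "proj (g \<otimes>\<^bsub>G\<^esub> inv\<^bsub>G\<^esub> h) x = proj (g \<otimes>\<^bsub>G\<^esub> inv\<^bsub>G\<^esub> h) y"
  shows "x \<ominus> y \<in> window I T g"
proof -
  have C: "x \<in> carrier R" "y \<in> carrier R" using assms window_closed by auto
  have "proj (g \<otimes>\<^bsub>G\<^esub> inv\<^bsub>G\<^esub> k) (x \<ominus> y) = \<zero>" if "k \<in> carrier G" "k \<notin> T" for k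
  proof (cases "k = h")
    case True
    then show ?thesis using assms C by (simp add: minus_eq r_neg)
  next
    case False
    then show ?thesis using window_minus[OF assms(1-3)] that by (simp add: window_def)
  qed
  then show ?thesis using window_minus[OF assms(1-3)] by (simp add: window_def)
qed

text \<open>Left multiplication moves \<open>g\<close> but leaves \<open>k\<close> in
  \<open>g k\<inverse>\<close> alone, so \<open>K\<close> is unchanged.\<close>

lemma window_mult:
  assumes "r \<in> Rgr u" "u \<in> carrier G" "x \<in> window I K (inv\<^bsub>G\<^esub> u \<otimes>\<^bsub>G\<^esub> g)" "g \<in> carrier G"
  shows "r \<otimes> x \<in> window I K g"
  using assms left_ideal_mult[OF I, of r] window_closed[OF assms(3)]
  by (simp add: window_def proj_mult_left G.m_assoc)

lemma window_empty:
  assumes "x \<in> window I {} g" "g \<in> carrier G"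
  shows "x = \<zero>"
proof (rule proj_ext)
  fix i assume i: "i \<in> carrier G"
  \<comment> \<open>Every degree \<open>i\<close> has the form \<open>g k\<inverse>\<close>, with
    \<open>k = i\<inverse> g\<close>, so all components of \<open>x\<close> vanish.\<close>
  have "g \<otimes>\<^bsub>G\<^esub> inv\<^bsub>G\<^esub> (inv\<^bsub>G\<^esub> i \<otimes>\<^bsub>G\<^esub> g) = i"
    using i assms by (simp add: G.inv_mult_group)
  moreover have "proj (g \<otimes>\<^bsub>G\<^esub> inv\<^bsub>G\<^esub> (inv\<^bsub>G\<^esub> i \<otimes>\<^bsub>G\<^esub> g)) x = \<zero>"
    using assms i by (simp add: window_def)
  ultimately show "proj i x = proj i \<zero>" using i by simp
qed (use assms window_closed in auto)

lemma window_idealD: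
  assumes "r \<in> window_ideal I K h" "g \<in> carrier G"
  obtains x where "x \<in> window I K g" "proj (g \<otimes>\<^bsub>G\<^esub> inv\<^bsub>G\<^esub> h) x = proj (g \<otimes>\<^bsub>G\<^esub> inv\<^bsub>G\<^esub> h) r"
  using assms by (auto simp: window_ideal_def)

text \<open>The element is homogeneous of degree \<open>g h\<inverse>\<close>. At \<open>g\<close>
  the witness is \<open>y\<close>; at any other \<open>g'\<close> the tested component is zero and
  so is the witness.\<close>

lemma proj_window_ideal:
  assumes "x \<in> carrier R" "g \<in> carrier G" "h \<in> carrier G" "y \<in> window I K g"
    "proj (g \<otimes>\<^bsub>G\<^esub> inv\<^bsub>G\<^esub> h) y = proj (g \<otimes>\<^bsub>G\<^esub> inv\<^bsub>G\<^esub> h) x"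
  shows "proj (g \<otimes>\<^bsub>G\<^esub> inv\<^bsub>G\<^esub> h) x \<in> window_ideal I K h"
  unfolding window_ideal_def
proof (intro CollectI conjI ballI)
  let ?r = "proj (g \<otimes>\<^bsub>G\<^esub> inv\<^bsub>G\<^esub> h) x"
  show "?r \<in> carrier R" using assms by simp
  fix g' assume g': "g' \<in> carrier G"
  show "\<exists>x\<in>window I K g'. proj (g' \<otimes>\<^bsub>G\<^esub> inv\<^bsub>G\<^esub> h) x = proj (g' \<otimes>\<^bsub>G\<^esub> inv\<^bsub>G\<^esub> h) ?r"
  proof (cases "g' = g")
    case True
    then show ?thesis using assms by (intro bexI[of _ y]) auto
  next
    case False
    then show ?thesis
      using assms g' by (intro bexI[of _ \<zero>]) (auto simp: window_zero proj_proj)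
  qed
qed

lemma left_ideal_window_ideal:
  assumes h: "h \<in> carrier G"
  shows "left_ideal (window_ideal I K h) R"
proof (rule left_idealI)
  let ?J = "window_ideal I K h"
  show sub: "?J \<subseteq> carrier R" by (auto simp: window_ideal_def)
  show "\<zero> \<in> ?J" unfolding window_ideal_def using window_zero by auto
  show add: "r \<oplus> r' \<in> ?J" if r: "r \<in> ?J" "r' \<in> ?J" for r r'
    unfolding window_ideal_def
  proof (intro CollectI conjI ballI)
    show "r \<oplus> r' \<in> carrier R" using r sub by auto
    fix g assume g: "g \<in> carrier G"
    obtain x where x: "x \<in> window I K g" "proj (g \<otimes>\<^bsub>G\<^esub> inv\<^bsub>G\<^esub> h) x = proj (g \<otimes>\<^bsub>G\<^esub> inv\<^bsub>G\<^esub> h) r"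
      using r(1) g by (rule window_idealD)
    obtain x' where x': "x' \<in> window I K g" "proj (g \<otimes>\<^bsub>G\<^esub> inv\<^bsub>G\<^esub> h) x' = proj (g \<otimes>\<^bsub>G\<^esub> inv\<^bsub>G\<^esub> h) r'"
      using r(2) g by (rule window_idealD)
    show "\<exists>x\<in>window I K g. proj (g \<otimes>\<^bsub>G\<^esub> inv\<^bsub>G\<^esub> h) x = proj (g \<otimes>\<^bsub>G\<^esub> inv\<^bsub>G\<^esub> h) (r \<oplus> r')"
      using r sub x x' g h
      by (intro bexI[of _ "x \<oplus> x'"]) (auto simp: window_add window_closed subset_iff)
  qed
  show "a \<otimes> r \<in> ?J" if a: "a \<in> carrier R" and r: "r \<in> ?J" for a r
    using a
  proof (induction rule: homogeneous_induct)
    case zero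
    then show ?case using r sub \<open>\<zero> \<in> ?J\<close> by auto
  next
    case (homogeneous u a)
    show ?case
      unfolding window_ideal_def
    proof (intro CollectI conjI ballI)
      show "a \<otimes> r \<in> carrier R" using homogeneous r sub by auto
      fix g assume g: "g \<in> carrier G"
      \<comment> \<open>For \<open>a\<close> of degree \<open>u\<close>, a witness for
        \<open>a \<otimes> r\<close> at \<open>g\<close> is \<open>a\<close> times a witness for
        \<open>r\<close> at \<open>u\<inverse> g\<close>.\<close>
      let ?g = "inv\<^bsub>G\<^esub> u \<otimes>\<^bsub>G\<^esub> g"
      have "?g \<in> carrier G" using g homogeneous by simp
      with r obtain x where x: "x \<in> window I K ?g" "proj (?g \<otimes>\<^bsub>G\<^esub> inv\<^bsub>G\<^esub> h) x = proj (?g \<otimes>\<^bsub>G\<^esub> inv\<^bsub>G\<^esub> h) r"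
        by (rule window_idealD)
      show "\<exists>x\<in>window I K g. proj (g \<otimes>\<^bsub>G\<^esub> inv\<^bsub>G\<^esub> h) x = proj (g \<otimes>\<^bsub>G\<^esub> inv\<^bsub>G\<^esub> h) (a \<otimes> r)"
      proof (rule bexI)
        show "a \<otimes> x \<in> window I K g" using x homogeneous g by (intro window_mult) auto
        show "proj (g \<otimes>\<^bsub>G\<^esub> inv\<^bsub>G\<^esub> h) (a \<otimes> x) = proj (g \<otimes>\<^bsub>G\<^esub> inv\<^bsub>G\<^esub> h) (a \<otimes> r)"
          using x homogeneous g h r sub window_closed[OF x(1)]
          by (auto simp: proj_mult_left G.m_assoc subset_iff)
      qed
    qed
  next
    case (add a b)
    then show ?case using \<open>\<And>r r'. r \<in> ?J \<Longrightarrow> r' \<in> ?J \<Longrightarrow> r \<oplus> r' \<in> ?J\<close> r sub by (auto simp: l_distr subset_iff)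
  qed
qed

lemma window_ideal_stable:
  assumes "r \<in> window_ideal I K h" "g \<in> carrier G" "h \<in> carrier G"
  shows "proj g r \<in> window_ideal I K h"
proof -
  \<comment> \<open>The window at \<open>g h\<close> is the one that sees the component of degree
    \<open>g\<close>.\<close>
  have "g \<otimes>\<^bsub>G\<^esub> h \<in> carrier G" using assms by simp
  with assms(1) obtain y where "y \<in> window I K (g \<otimes>\<^bsub>G\<^esub> h)"
      "proj (g \<otimes>\<^bsub>G\<^esub> h \<otimes>\<^bsub>G\<^esub> inv\<^bsub>G\<^esub> h) y = proj (g \<otimes>\<^bsub>G\<^esub> h \<otimes>\<^bsub>G\<^esub> inv\<^bsub>G\<^esub> h) r"
    by (rule window_idealD)
  then have "proj (g \<otimes>\<^bsub>G\<^esub> h \<otimes>\<^bsub>G\<^esub> inv\<^bsub>G\<^esub> h) r \<in> window_ideal I K h"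
    using assms by (intro proj_window_ideal[where y = y]) (auto simp: window_ideal_def)
  then show ?thesis using assms by simp
qed

end

lemma window_mono: "I \<subseteq> I' \<Longrightarrow> window I K g \<subseteq> window I' K g"
  by (auto simp: window_def)

lemma window_ideal_mono: "I \<subseteq> I' \<Longrightarrow> window_ideal I K h \<subseteq> window_ideal I' K h"
  unfolding window_ideal_def using window_mono[of I I' K] by blast

text \<open>For a left ideal closed under components, the grading of the ring pulls back along the
  inclusion.\<close>

lemma graded_left_idealI:
  assumes J: "left_ideal J R" and stable: "\<And>x g. x \<in> J \<Longrightarrow> g \<in> carrier G \<Longrightarrow> proj g x \<in> J"
  shows "graded_left_ideal G R Rgr J"
proof -
  have sub: "x \<in> J \<Longrightarrow> x \<in> carrier R" for x using left_ideal_subset[OF J] by auto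
  have "abelian_group (R\<lparr>carrier := J\<rparr>)"
  proof (rule abelian_groupI)
    show "\<exists>y\<in>carrier (R\<lparr>carrier := J\<rparr>). y \<oplus>\<^bsub>R\<lparr>carrier := J\<rparr>\<^esub> x = \<zero>\<^bsub>R\<lparr>carrier := J\<rparr>\<^esub>"
      if "x \<in> carrier (R\<lparr>carrier := J\<rparr>)" for x
      using that by (intro bexI[of _ "\<ominus> x"]) (auto simp: left_ideal_a_inv[OF J] l_neg sub)
  qed (auto simp: left_ideal_add[OF J] left_ideal_zero[OF J] sub a_ac)
  then have "internal_direct_sum (R\<lparr>carrier := J\<rparr>) (carrier G) (\<lambda>g. J \<inter> Rgr g)"
    by (rule internal_direct_sum_pullback[where f = id and \<sigma> = id])
      (auto simp: sub stable bij_betw_def)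
  with J show ?thesis by (simp add: graded_left_ideal_def)
qed

subsection \<open>Chain conditions\<close>

text \<open>Induction on \<open>T\<close>. The single chain of graded left ideals \<open>?J\<close>
  controls the new component in the windows at all \<open>g\<close> simultaneously, so
  \<open>n\<close> is uniform in \<open>g\<close> even if the group is infinite.\<close>

lemma window_chain_stabilizes:
  fixes I :: "nat \<Rightarrow> 'a set"
  assumes noeth: "graded_left_noetherian G R Rgr"
    and I: "\<And>n. left_ideal (I n) R" and mono: "mono I"
    and "finite T" "T \<subseteq> carrier G"
  shows "\<exists>n. \<forall>m\<ge>n. \<forall>g\<in>carrier G. window (I m) T g \<subseteq> I n"
  using \<open>finite T\<close> \<open>T \<subseteq> carrier G\<close>
proof induction
  case empty
  then show ?case using window_empty[OF I] left_ideal_zero[OF I] by blast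
next
  case (insert h T)
  then have h: "h \<in> carrier G" and "\<exists>n. \<forall>m\<ge>n. \<forall>g\<in>carrier G. window (I m) T g \<subseteq> I n" by auto
  then obtain n1 where n1: "\<And>m g. m \<ge> n1 \<Longrightarrow> g \<in> carrier G \<Longrightarrow> window (I m) T g \<subseteq> I n1" by blast
  let ?J = "\<lambda>n. window_ideal (I n) (insert h T) h"
  have "graded_left_ideal G R Rgr (?J n)" for n
    using h I by (intro graded_left_idealI left_ideal_window_ideal window_ideal_stable)
  moreover have "?J n \<subseteq> ?J (Suc n)" for n
    using mono by (intro window_ideal_mono) (simp add: mono_def)
  ultimately obtain n2 where n2: "\<And>m. m \<ge> n2 \<Longrightarrow> ?J m = ?J n2"
    using noeth[unfolded graded_left_noetherian_def, rule_format, of ?J] by auto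
  define n where "n = max n1 n2"
  have "x \<in> I n" if m: "m \<ge> n" and g: "g \<in> carrier G" and x: "x \<in> window (I m) (insert h T) g" for m g x
  proof -
    let ?t = "g \<otimes>\<^bsub>G\<^esub> inv\<^bsub>G\<^esub> h"
    have xR: "x \<in> carrier R" by (rule window_closed[OF I x])
    have t: "?t \<in> carrier G" using g h by simp
    \<comment> \<open>Stability of \<open>?J\<close> trades \<open>m\<close> for \<open>n\<close>:
      some \<open>y\<close> in \<open>I n\<close> has the same component at \<open>?t\<close> as
      \<open>x\<close>. The difference lies in the smaller window, which the induction hypothesis
      covers.\<close>
    have "proj ?t x \<in> ?J m" using xR g h x by (intro proj_window_ideal[OF I]) auto
    also have "?J m = ?J n" using n2[of m] n2[of n] m by (simp add: n_def)
    finally have "proj ?t x \<in> ?J n" .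
    then obtain y where y: "y \<in> window (I n) (insert h T) g" "proj ?t y = proj ?t (proj ?t x)"
      using g by (rule window_idealD[OF I])
    have yR: "y \<in> carrier R" by (rule window_closed[OF I y(1)])
    have "y \<in> window (I m) (insert h T) g"
      using y(1) window_mono[of "I n" "I m"] monoD[OF mono m] by blast
    then have "x \<ominus> y \<in> window (I m) T g"
      using xR y(2) t by (intro window_minus_cancel[OF I x _ g h]) auto
    then have "x \<ominus> y \<in> I n1" using n1[of m g] m g by (auto simp: n_def)
    also have "I n1 \<subseteq> I n" using mono by (auto simp: n_def mono_def)
    finally have "(x \<ominus> y) \<oplus> y \<in> I n"
      using left_ideal_add[OF I] window_subset[OF I y(1)] by blast
    then show ?thesis using xR yR by (simp add: minus_eq a_assoc l_neg)
  qed
  then show ?case by blast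
qed

lemma left_noetherian_if_graded:
  assumes "graded_left_noetherian G R Rgr"
  shows "left_noetherian R"
  unfolding left_noetherian_def
proof (intro allI impI, elim conjE)
  fix I :: "nat \<Rightarrow> 'a set"
  assume I: "\<forall>n. left_ideal (I n) R" and "\<forall>n. I n \<subseteq> I (Suc n)"
  then have mono: "mono I" by (simp add: mono_iff_le_Suc)
  let ?S = "{g \<in> carrier G. Rgr g \<noteq> {\<zero>}}"
  \<comment> \<open>At the neutral degree, \<open>k\<close> refers to the component of degree
    \<open>k\<inverse>\<close>. With the inverses of the support, the window there is the whole
    ideal.\<close>
  let ?T = "(\<lambda>g. inv\<^bsub>G\<^esub> g) ` ?S"
  have "\<exists>n. \<forall>m\<ge>n. \<forall>g\<in>carrier G. window (I m) ?T g \<subseteq> I n"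
    using I mono finite_support by (intro window_chain_stabilizes[OF assms]) auto
  then obtain n where n: "\<And>m g. m \<ge> n \<Longrightarrow> g \<in> carrier G \<Longrightarrow> window (I m) ?T g \<subseteq> I n" by blast
  have "I m \<subseteq> I n" if m: "m \<ge> n" for m
  proof
    fix x assume x: "x \<in> I m"
    have xR: "x \<in> carrier R" using left_ideal_subset[of "I m"] I x by auto
    have "proj (\<one>\<^bsub>G\<^esub> \<otimes>\<^bsub>G\<^esub> inv\<^bsub>G\<^esub> k) x = \<zero>" if k: "k \<in> carrier G" "k \<notin> ?T" for k
    proof -
      have "inv\<^bsub>G\<^esub> k \<notin> ?S" using k by (metis (no_types, lifting) G.inv_inv image_eqI)
      then have "Rgr (inv\<^bsub>G\<^esub> k) = {\<zero>}" using k by simp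
      then show ?thesis using proj_homogeneous[OF xR, of "inv\<^bsub>G\<^esub> k"] k by simp
    qed
    then have "x \<in> window (I m) ?T \<one>\<^bsub>G\<^esub>" using x by (simp add: window_def)
    then show "x \<in> I n" using n[OF m, of "\<one>\<^bsub>G\<^esub>"] by auto
  qed
  moreover have "I n \<subseteq> I m" if "m \<ge> n" for m using mono that by (simp add: mono_def)
  ultimately show "\<exists>n. \<forall>m\<ge>n. I m = I n" by blast
qed

lemma graded_noetherian_if_left_noetherian:
  assumes "left_noetherian R"
  shows "graded_left_noetherian G R Rgr"
  using assms unfolding left_noetherian_def graded_left_noetherian_def graded_left_ideal_def by blast

subsection \<open>Injectivity\<close>

text \<open>Elements of degree \<open>t\<close> are placed in degree \<open>t h\<close>, so that a
  homomorphism of degree \<open>h\<close> becomes degree-preserving. A shift from the right respects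
  the left module structure.\<close>

lemma graded_left_module_copy_module:
  fixes J h
  defines "N \<equiv> copy_module R J :: ('a, 'a + 'u) module"
  assumes J: "left_ideal J R" and stable: "\<And>x g. x \<in> J \<Longrightarrow> g \<in> carrier G \<Longrightarrow> proj g x \<in> J"
    and h: "h \<in> carrier G"
  shows "graded_left_module G R Rgr N (\<lambda>g. Inl ` (J \<inter> Rgr (g \<otimes>\<^bsub>G\<^esub> inv\<^bsub>G\<^esub> h)))"
proof -
  have sub: "x \<in> J \<Longrightarrow> x \<in> carrier R" for x using left_ideal_subset[OF J] by auto
  have N: "left_module R N" unfolding N_def by (rule left_module_copy_module[OF J])
  have "bij_betw (\<lambda>g. g \<otimes>\<^bsub>G\<^esub> inv\<^bsub>G\<^esub> h) (carrier G) (carrier G)"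
    by (rule bij_betwI[where g = "\<lambda>g. g \<otimes>\<^bsub>G\<^esub> h"]) (use h in auto)
  then have "internal_direct_sum N (carrier G) (\<lambda>g. Inl ` (J \<inter> Rgr (g \<otimes>\<^bsub>G\<^esub> inv\<^bsub>G\<^esub> h)))"
    using left_module.axioms(2)[OF N]
    by (intro internal_direct_sum_pullback[where f = projl])
      (auto simp: N_def sub stable image_image inj_on_def)
  moreover have "a \<otimes> x \<in> J \<inter> Rgr (g \<otimes>\<^bsub>G\<^esub> k \<otimes>\<^bsub>G\<^esub> inv\<^bsub>G\<^esub> h)"
    if "g \<in> carrier G" "k \<in> carrier G" "a \<in> Rgr g" "x \<in> J" "x \<in> Rgr (k \<otimes>\<^bsub>G\<^esub> inv\<^bsub>G\<^esub> h)" for g k a x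
    using that h graded_mult[of g "k \<otimes>\<^bsub>G\<^esub> inv\<^bsub>G\<^esub> h" a x] by (simp add: G.m_assoc left_ideal_mult[OF J])
  ultimately show ?thesis
    unfolding graded_left_module_def using N by (auto simp: N_def)
qed

text \<open>The graded form of Baer's condition: \<open>f\<close> is extended from the shifted copy
  of \<open>J\<close> to the shifted copy of the ring, and \<open>b\<close> is the image of
  one.\<close>

lemma graded_hom_extends_to_right_mult:
  assumes inj: "graded_injective_module TYPE('a + 'u) G R Rgr (regular_module R) Rgr"
    and J: "left_ideal J R" and stable: "\<And>x g. x \<in> J \<Longrightarrow> g \<in> carrier G \<Longrightarrow> proj g x \<in> J"
    and h: "h \<in> carrier G"
    and f: "f \<in> left_module_hom R ((regular_module R)\<lparr>carrier := J\<rparr>) (regular_module R)"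
    and deg: "\<And>r t. r \<in> J \<Longrightarrow> t \<in> carrier G \<Longrightarrow> r \<in> Rgr t \<Longrightarrow> f r \<in> Rgr (t \<otimes>\<^bsub>G\<^esub> h)"
  shows "\<exists>b\<in>Rgr h. \<forall>r\<in>J. f r = r \<otimes> b"
proof -
  let ?N = "copy_module R J :: ('a, 'a + 'u) module"
  let ?M = "copy_module R (carrier R) :: ('a, 'a + 'u) module"
  define gr where "gr J g = (Inl ` (J \<inter> Rgr (g \<otimes>\<^bsub>G\<^esub> inv\<^bsub>G\<^esub> h)) :: ('a + 'u) set)" for J g
  have sub: "J \<subseteq> carrier R" by (rule left_ideal_subset[OF J])
  have N: "graded_left_module G R Rgr ?N (gr J)"
    unfolding gr_def by (rule graded_left_module_copy_module[OF J stable h])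
  have M: "graded_left_module G R Rgr ?M (gr (carrier R))"
    unfolding gr_def by (rule graded_left_module_copy_module[OF left_ideal_carrier _ h]) simp
  have i: "id \<in> graded_hom G R ?N (gr J) ?M (gr (carrier R))" "inj_on id (carrier ?N)"
    using sub by (auto simp: graded_hom_def left_module_hom_def gr_def)
  have f': "f \<circ> projl \<in> graded_hom G R ?N (gr J) (regular_module R) Rgr"
  proof -
    have "f r \<in> Rgr g" if "g \<in> carrier G" "r \<in> J" "r \<in> Rgr (g \<otimes>\<^bsub>G\<^esub> inv\<^bsub>G\<^esub> h)" for g r
      using deg[of r "g \<otimes>\<^bsub>G\<^esub> inv\<^bsub>G\<^esub> h"] that h by simp
    then show ?thesis using f by (auto simp: graded_hom_def left_module_hom_def gr_def Pi_iff)
  qed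
  obtain k where k: "k \<in> graded_hom G R ?M (gr (carrier R)) (regular_module R) Rgr"
      "\<forall>x\<in>carrier ?N. k (id x) = (f \<circ> projl) x"
    using inj N M i f' unfolding graded_injective_module_def by blast
  have "f r = r \<otimes> k (Inl \<one>)" if "r \<in> J" for r
  proof -
    have r: "r \<in> carrier R" using that sub by auto
    have "\<forall>a\<in>carrier R. \<forall>x\<in>carrier ?M. k (a \<odot>\<^bsub>?M\<^esub> x) = a \<otimes> k x"
      using k(1) by (simp add: graded_hom_def left_module_hom_def)
    from this[rule_format, of r "Inl \<one>"] have "k (Inl r) = r \<otimes> k (Inl \<one>)" using r by simp
    then show ?thesis using k(2) that r by auto
  qed
  \<comment> \<open>In the shifted copy one has degree \<open>h\<close>, and \<open>k\<close>
    preserves degrees.\<close>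
  moreover have "k (Inl \<one>) \<in> Rgr h"
  proof -
    have "Inl \<one> \<in> gr (carrier R) h" using h one_homogeneous by (auto simp: gr_def)
    then show ?thesis using k(1) h by (auto simp: graded_hom_def)
  qed
  ultimately show ?thesis by blast
qed

lemma left_module_hom_regular_iff:
  "f \<in> left_module_hom R ((regular_module R)\<lparr>carrier := I\<rparr>) (regular_module R) \<longleftrightarrow>
    f \<in> I \<rightarrow> carrier R \<and> (\<forall>x\<in>I. \<forall>y\<in>I. f (x \<oplus> y) = f x \<oplus> f y) \<and>
    (\<forall>a\<in>carrier R. \<forall>x\<in>I. f (a \<otimes> x) = a \<otimes> f x)"
  by (simp add: left_module_hom_def)

text \<open>On the larger window the degree \<open>g\<close> part of \<open>f x\<close> depends only
  on the component of \<open>x\<close> at \<open>g h\<inverse>\<close>, because of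
  \<open>vanish\<close>. These dependences for all \<open>g\<close> combine to one homomorphism
  \<open>\<phi>\<close> of degree \<open>h\<close> on the graded left ideal \<open>?J\<close>, and
  graded injectivity turns it into right multiplication by \<open>b\<close>.\<close>

lemma window_hom_step:
  assumes inj: "graded_injective_module TYPE('a + 'u) G R Rgr (regular_module R) Rgr"
    and I: "left_ideal I R" and h: "h \<in> carrier G"
    and f: "f \<in> left_module_hom R ((regular_module R)\<lparr>carrier := I\<rparr>) (regular_module R)"
    and vanish: "\<And>g x. g \<in> carrier G \<Longrightarrow> x \<in> window I T g \<Longrightarrow> proj g (f x) = \<zero>"
  shows "\<exists>b\<in>carrier R. \<forall>g\<in>carrier G. \<forall>x\<in>window I (insert h T) g. proj g (f x) = proj g (x \<otimes> b)"
proof -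
  let ?W = "window I (insert h T)" and ?J = "window_ideal I (insert h T) h"
  let ?p = "\<lambda>g. proj (g \<otimes>\<^bsub>G\<^esub> inv\<^bsub>G\<^esub> h)"
  have fC [simp]: "f x \<in> carrier R" if "x \<in> I" for x using f that by (auto simp: left_module_hom_regular_iff)
  have fadd: "f (x \<oplus> y) = f x \<oplus> f y" if "x \<in> I" "y \<in> I" for x y
    using f that by (auto simp: left_module_hom_regular_iff)
  have fmult: "f (a \<otimes> x) = a \<otimes> f x" if "a \<in> carrier R" "x \<in> I" for a x
    using f that by (auto simp: left_module_hom_regular_iff)
  have f0: "f \<zero> = \<zero>" using fmult[of \<zero> \<zero>] left_ideal_zero[OF I] by simp
  note WI = window_subset[OF I] and WC = window_closed[OF I]
  have th: "g \<otimes>\<^bsub>G\<^esub> inv\<^bsub>G\<^esub> h \<in> carrier G" if "g \<in> carrier G" for g using that h by simp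
  have wd: "proj g (f x) = proj g (f y)"
    if "g \<in> carrier G" "x \<in> ?W g" "y \<in> ?W g" "?p g x = ?p g y" for g x y
  proof -
    have d: "x \<ominus> y \<in> window I T g" using that h by (intro window_minus_cancel[OF I]) auto
    have "f x = f ((x \<ominus> y) \<oplus> y)" using WC that by (simp add: minus_eq a_assoc l_neg)
    also have "\<dots> = f (x \<ominus> y) \<oplus> f y" using WI[OF d] WI[OF that(3)] by (rule fadd)
    finally show ?thesis using vanish[OF that(1) d] WI[OF d] WI[OF that(3)] that(1) by simp
  qed
  \<comment> \<open>the graph of \<open>r \<mapsto> \<phi> r\<close>, where \<open>\<phi> (x\<^sub>t) = f(x)\<^sub>g\<close> for \<open>t = g h\<inverse>\<close>; \<open>wd\<close> makes it single-valued\<close>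
  define \<Phi> where "\<Phi> r y \<longleftrightarrow> r \<in> carrier R \<and> y \<in> carrier R \<and>
    (\<forall>g\<in>carrier G. \<exists>x\<in>?W g. ?p g x = ?p g r \<and> proj g y = proj g (f x))" for r y
  have \<Phi>D: "proj g y = proj g (f x)" if "\<Phi> r y" "g \<in> carrier G" "x \<in> ?W g" "?p g x = ?p g r" for r y g x
    using that wd unfolding \<Phi>_def by metis
  \<comment> \<open>A witness is chosen separately for each \<open>g\<close>;
    \<open>ex_proj_eq\<close> assembles the resulting components into one value.\<close>
  have ex: "\<exists>y. \<Phi> r y" if r: "r \<in> ?J" for r
  proof -
    have "\<forall>g\<in>carrier G. \<exists>x. x \<in> ?W g \<and> ?p g x = ?p g r" using r by (auto simp: window_ideal_def)
    then obtain x where x: "\<And>g. g \<in> carrier G \<Longrightarrow> x g \<in> ?W g \<and> ?p g (x g) = ?p g r" by metis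
    have "\<exists>y\<in>carrier R. \<forall>g\<in>carrier G. proj g y = proj g (f (x g))"
      using x WI by (intro ex_proj_eq proj_homogeneous fC) auto
    then show ?thesis using x r unfolding \<Phi>_def window_ideal_def by blast
  qed
  have uniq: "y = y'" if "\<Phi> r y" "\<Phi> r y'" for r y y'
  proof (rule proj_ext)
    show "proj g y = proj g y'" if g: "g \<in> carrier G" for g
      using \<Phi>D[OF \<open>\<Phi> r y\<close> g] \<open>\<Phi> r y'\<close> g unfolding \<Phi>_def by metis
  qed (use that in \<open>auto simp: \<Phi>_def\<close>)
  define \<phi> where "\<phi> r = (THE y. \<Phi> r y)" for r
  have \<phi>_eq: "\<phi> r = y" if "\<Phi> r y" for r y unfolding \<phi>_def using that uniq by blast
  have \<phi>: "\<Phi> r (\<phi> r)" if "r \<in> ?J" for r using ex[OF that] \<phi>_eq by auto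
  have \<Phi>_add: "\<Phi> (r \<oplus> r') (y \<oplus> y')" if a: "\<Phi> r y" "\<Phi> r' y'" for r r' y y'
    unfolding \<Phi>_def
  proof (intro conjI ballI)
    show "r \<oplus> r' \<in> carrier R" "y \<oplus> y' \<in> carrier R" using a by (auto simp: \<Phi>_def)
    fix g assume g: "g \<in> carrier G"
    obtain x where x: "x \<in> ?W g" "?p g x = ?p g r" "proj g y = proj g (f x)"
      using a(1) g unfolding \<Phi>_def by blast
    obtain x' where x': "x' \<in> ?W g" "?p g x' = ?p g r'" "proj g y' = proj g (f x')"
      using a(2) g unfolding \<Phi>_def by blast
    have "?p g (x \<oplus> x') = ?p g (r \<oplus> r')"
      using x x' a WC[OF x(1)] WC[OF x'(1)] th[OF g] by (simp add: \<Phi>_def)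
    moreover have "proj g (y \<oplus> y') = proj g (f (x \<oplus> x'))"
      using x x' a WI[OF x(1)] WI[OF x'(1)] g by (simp add: \<Phi>_def fadd)
    ultimately show "\<exists>x\<in>?W g. ?p g x = ?p g (r \<oplus> r') \<and> proj g (y \<oplus> y') = proj g (f x)"
      using window_add[OF I x(1) x'(1) g] by blast
  qed
  have \<Phi>_zero: "\<Phi> \<zero> \<zero>"
    unfolding \<Phi>_def using window_zero[OF I] f0 by auto
  have \<Phi>_mult: "\<Phi> (a \<otimes> r) (a \<otimes> y)" if a: "a \<in> carrier R" and r: "\<Phi> r y" for a r y
    using a
  proof (induction rule: homogeneous_induct)
    case zero
    then show ?case using \<Phi>_zero r by (simp add: \<Phi>_def)
  next
    case (homogeneous u a)
    have C: "r \<in> carrier R" "y \<in> carrier R" "a \<in> carrier R" using r homogeneous by (auto simp: \<Phi>_def)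
    show ?case
      unfolding \<Phi>_def
    proof (intro conjI ballI)
      show "a \<otimes> r \<in> carrier R" "a \<otimes> y \<in> carrier R" using C by auto
      fix g assume g: "g \<in> carrier G"
      let ?g = "inv\<^bsub>G\<^esub> u \<otimes>\<^bsub>G\<^esub> g"
      have g': "?g \<in> carrier G" using g homogeneous by simp
      then obtain x where x: "x \<in> ?W ?g" "?p ?g x = ?p ?g r" "proj ?g y = proj ?g (f x)"
        using r unfolding \<Phi>_def by blast
      show "\<exists>x\<in>?W g. ?p g x = ?p g (a \<otimes> r) \<and> proj g (a \<otimes> y) = proj g (f x)"
      proof (intro bexI conjI)
        show "a \<otimes> x \<in> ?W g" using x homogeneous g by (intro window_mult[OF I]) auto
        show "?p g (a \<otimes> x) = ?p g (a \<otimes> r)"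
          using x homogeneous g h C WC[OF x(1)] by (simp add: proj_mult_left G.m_assoc)
        show "proj g (a \<otimes> y) = proj g (f (a \<otimes> x))"
          using x homogeneous g C WI[OF x(1)] by (simp add: fmult proj_mult_left)
      qed
    qed
  next
    case (add a b)
    then show ?case using \<Phi>_add[of "a \<otimes> r" "a \<otimes> y" "b \<otimes> r" "b \<otimes> y"] r by (simp add: \<Phi>_def l_distr)
  qed
  have hom: "\<phi> \<in> left_module_hom R ((regular_module R)\<lparr>carrier := ?J\<rparr>) (regular_module R)"
    unfolding left_module_hom_regular_iff
  proof (intro conjI ballI funcsetI)
    show "\<phi> r \<in> carrier R" if "r \<in> ?J" for r using \<phi>[OF that] by (simp add: \<Phi>_def)
    show "\<phi> (r \<oplus> r') = \<phi> r \<oplus> \<phi> r'" if "r \<in> ?J" "r' \<in> ?J" for r r'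
      by (rule \<phi>_eq[OF \<Phi>_add[OF \<phi>[OF that(1)] \<phi>[OF that(2)]]])
    show "\<phi> (a \<otimes> r) = a \<otimes> \<phi> r" if "a \<in> carrier R" "r \<in> ?J" for a r
      by (rule \<phi>_eq[OF \<Phi>_mult[OF that(1) \<phi>[OF that(2)]]])
  qed
  \<comment> \<open>For \<open>g\<close> other than \<open>t h\<close> the component of
    \<open>r\<close> at \<open>g h\<inverse>\<close> vanishes, so zero is a witness and the degree
    \<open>g\<close> part of \<open>\<phi> r\<close> is that of \<open>f \<zero>\<close>.\<close>
  have deg: "\<phi> r \<in> Rgr (t \<otimes>\<^bsub>G\<^esub> h)" if r: "r \<in> ?J" and t: "t \<in> carrier G" "r \<in> Rgr t" for r t
  proof -
    have C: "\<phi> r \<in> carrier R" using \<phi>[OF r] by (simp add: \<Phi>_def)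
    have "\<phi> r = proj (t \<otimes>\<^bsub>G\<^esub> h) (\<phi> r)"
    proof (rule proj_ext)
      fix g assume g: "g \<in> carrier G"
      show "proj g (\<phi> r) = proj g (proj (t \<otimes>\<^bsub>G\<^esub> h) (\<phi> r))"
      proof (cases "g = t \<otimes>\<^bsub>G\<^esub> h")
        case True
        then show ?thesis using C t h by simp
      next
        case False
        then have "g \<otimes>\<^bsub>G\<^esub> inv\<^bsub>G\<^esub> h \<noteq> t" using g h t by auto
        then have "?p g r = \<zero>" using t th[OF g] by (simp add: proj_of_homogeneous)
        then have "proj g (\<phi> r) = \<zero>"
          using \<Phi>D[OF \<phi>[OF r] g window_zero[OF I g]] th[OF g] g by (simp add: f0)
        then show ?thesis using False g t h C by (simp add: proj_proj)
      qed
    qed (use C t h in auto)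
    then show ?thesis using proj_homogeneous[OF C, of "t \<otimes>\<^bsub>G\<^esub> h"] t h by simp
  qed
  have "\<exists>b\<in>Rgr h. \<forall>r\<in>?J. \<phi> r = r \<otimes> b"
    using I h hom deg
    by (intro graded_hom_extends_to_right_mult[OF inj] left_ideal_window_ideal window_ideal_stable)
  then obtain b where b: "b \<in> Rgr h" "\<And>r. r \<in> ?J \<Longrightarrow> \<phi> r = r \<otimes> b" by blast
  have "proj g (f x) = proj g (x \<otimes> b)" if g: "g \<in> carrier G" and x: "x \<in> ?W g" for g x
  proof -
    have xC: "x \<in> carrier R" by (rule WC[OF x])
    have r: "?p g x \<in> ?J" using xC g h x by (intro proj_window_ideal[OF I]) auto
    \<comment> \<open>\<open>x\<close> itself witnesses its component at
      \<open>g h\<inverse>\<close>. Since \<open>b\<close> has degree \<open>h\<close>, only that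
      component contributes to the degree \<open>g\<close> part of
      \<open>x \<otimes> b\<close>.\<close>
    have "proj g (f x) = proj g (\<phi> (?p g x))"
      using \<Phi>D[OF \<phi>[OF r] g x] xC th[OF g] by simp
    also have "\<dots> = proj g (?p g x \<otimes> b)" using b r by simp
    also have "\<dots> = ?p g (?p g x) \<otimes> b" using b(1) h g xC th[OF g] by (intro proj_mult_right) auto
    also have "\<dots> = ?p g x \<otimes> b" using xC th[OF g] by simp
    also have "\<dots> = proj g (x \<otimes> b)" using b(1) h g xC by (simp add: proj_mult_right)
    finally show ?thesis .
  qed
  moreover have "b \<in> carrier R" using b(1) h by simp
  ultimately show ?thesis by blast
qed

lemma window_hom_right_mult:
  assumes inj: "graded_injective_module TYPE('a + 'u) G R Rgr (regular_module R) Rgr"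
    and I: "left_ideal I R"
    and f: "f \<in> left_module_hom R ((regular_module R)\<lparr>carrier := I\<rparr>) (regular_module R)"
    and "finite T" "T \<subseteq> carrier G"
  shows "\<exists>a\<in>carrier R. \<forall>g\<in>carrier G. \<forall>x\<in>window I T g. proj g (f x) = proj g (x \<otimes> a)"
  using \<open>finite T\<close> \<open>T \<subseteq> carrier G\<close>
proof induction
  have fC: "f x \<in> carrier R" if "x \<in> I" for x using f that by (auto simp: left_module_hom_regular_iff)
  case empty
  have "f \<zero> = \<zero>"
  proof -
    have "\<forall>a\<in>carrier R. \<forall>x\<in>I. f (a \<otimes> x) = a \<otimes> f x"
      using f by (simp add: left_module_hom_regular_iff)
    from this[rule_format, of \<zero> \<zero>] show ?thesis using left_ideal_zero[OF I] fC by simp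
  qed
  then have "\<forall>g\<in>carrier G. \<forall>x\<in>window I {} g. proj g (f x) = proj g (x \<otimes> \<zero>)"
    using window_empty[OF I] by fastforce
  then show ?case by blast
next
  case (insert h T)
  then obtain a where a: "a \<in> carrier R"
      "\<And>g x. g \<in> carrier G \<Longrightarrow> x \<in> window I T g \<Longrightarrow> proj g (f x) = proj g (x \<otimes> a)"
    by auto
  \<comment> \<open>The error of the approximation by \<open>a\<close>: it vanishes on the windows
    for \<open>T\<close>, so \<open>window_hom_step\<close> supplies a correction \<open>b\<close>,
    and \<open>b \<oplus> a\<close> represents \<open>f\<close> on the larger windows.\<close>
  define f' where "f' x = f x \<ominus> x \<otimes> a" for x
  have IC: "x \<in> carrier R" if "x \<in> I" for x using left_ideal_subset[OF I] that by auto
  have fC: "f x \<in> carrier R" if "x \<in> I" for x using f that by (auto simp: left_module_hom_regular_iff)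
  have f': "f' \<in> left_module_hom R ((regular_module R)\<lparr>carrier := I\<rparr>) (regular_module R)"
    unfolding left_module_hom_regular_iff
  proof (intro conjI ballI funcsetI)
    show "f' x \<in> carrier R" if "x \<in> I" for x using that fC IC a(1) by (simp add: f'_def)
    show "f' (x \<oplus> y) = f' x \<oplus> f' y" if "x \<in> I" "y \<in> I" for x y
    proof -
      have "f (x \<oplus> y) = f x \<oplus> f y" using that f by (simp add: left_module_hom_regular_iff)
      then have "f' (x \<oplus> y) = (f x \<oplus> f y) \<oplus> (\<ominus> (x \<otimes> a) \<oplus> \<ominus> (y \<otimes> a))"
        using that IC a(1) by (simp add: f'_def minus_eq l_distr minus_add)
      also have "\<dots> = f' x \<oplus> f' y"
        using fC[OF that(1)] fC[OF that(2)] IC[OF that(1)] IC[OF that(2)] a(1)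
        by (simp add: f'_def minus_eq a_ac)
      finally show ?thesis .
    qed
    show "f' (r \<otimes> x) = r \<otimes> f' x" if "r \<in> carrier R" "x \<in> I" for r x
    proof -
      have "f (r \<otimes> x) = r \<otimes> f x" using that f by (simp add: left_module_hom_regular_iff)
      then show ?thesis
        using that(1) fC[OF that(2)] IC[OF that(2)] a(1)
        by (simp add: f'_def minus_eq r_distr r_minus m_assoc)
    qed
  qed
  have "proj g (f' x) = \<zero>" if "g \<in> carrier G" "x \<in> window I T g" for g x
    using that a fC IC window_subset[OF I that(2)] by (simp add: f'_def minus_eq r_neg)
  then obtain b where b: "b \<in> carrier R"
      "\<And>g x. g \<in> carrier G \<Longrightarrow> x \<in> window I (insert h T) g \<Longrightarrow> proj g (f' x) = proj g (x \<otimes> b)"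
    using window_hom_step[OF inj I _ f', of h T] insert by auto
  have "proj g (f x) = proj g (x \<otimes> (b \<oplus> a))"
    if g: "g \<in> carrier G" and x: "x \<in> window I (insert h T) g" for g x
  proof -
    have C: "x \<in> carrier R" "f x \<in> carrier R" using window_subset[OF I x] IC fC by auto
    have "f' x \<in> carrier R" using C a(1) by (simp add: f'_def)
    moreover have "f x = f' x \<oplus> x \<otimes> a" using C a(1) by (simp add: f'_def minus_eq a_assoc l_neg)
    ultimately have "proj g (f x) = proj g (f' x) \<oplus> proj g (x \<otimes> a)"
      using C a(1) g by simp
    also have "\<dots> = proj g (x \<otimes> (b \<oplus> a))" using b g x a(1) C by (simp add: r_distr)
    finally show ?thesis .
  qed
  then show ?case using a(1) b(1) by (intro bexI[of _ "b \<oplus> a"]) auto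
qed

lemma baer_condition_if_graded_injective:
  assumes "graded_injective_module TYPE('a + 'u) G R Rgr (regular_module R) Rgr"
  shows "baer_condition R (regular_module R)"
  unfolding baer_condition_def
proof (intro allI impI, elim conjE)
  fix I f assume I: "left_ideal I R"
    and f: "f \<in> left_module_hom R ((regular_module R)\<lparr>carrier := I\<rparr>) (regular_module R)"
  let ?S = "{g \<in> carrier G. Rgr g \<noteq> {\<zero>}}"
  \<comment> \<open>These quotients are chosen so that, for \<open>g\<close> in the support, the
    window at \<open>g\<close> is all of \<open>I\<close>: for \<open>k\<close> outside
    \<open>?T\<close>, the degree \<open>g k\<inverse>\<close> lies outside the support. For other
    \<open>g\<close> both sides have zero component.\<close>
  let ?T = "(\<lambda>(s, g). inv\<^bsub>G\<^esub> s \<otimes>\<^bsub>G\<^esub> g) ` (?S \<times> ?S)"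
  have "finite ?T" "?T \<subseteq> carrier G" using finite_support by auto
  from window_hom_right_mult[OF assms I f this] obtain a where a: "a \<in> carrier R"
    "\<And>g x. g \<in> carrier G \<Longrightarrow> x \<in> window I ?T g \<Longrightarrow> proj g (f x) = proj g (x \<otimes> a)" by blast
  have supp: "proj g x = \<zero>" if "g \<in> carrier G" "g \<notin> ?S" "x \<in> carrier R" for g x
  proof -
    have "Rgr g = {\<zero>}" using that by simp
    then show ?thesis using proj_homogeneous[of x g] that by simp
  qed
  have "f x = x \<otimes> a" if x: "x \<in> I" for x
  proof (rule proj_ext)
    show xC: "f x \<in> carrier R" "x \<otimes> a \<in> carrier R"
      using f x left_ideal_subset[OF I] a(1) by (simp_all add: left_module_hom_regular_iff Pi_iff subset_iff)
    fix g assume g: "g \<in> carrier G"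
    show "proj g (f x) = proj g (x \<otimes> a)"
    proof (cases "g \<in> ?S")
      case True
      have "x \<in> window I ?T g"
        unfolding window_def
      proof (intro CollectI conjI ballI x)
        fix k assume k: "k \<in> carrier G - ?T"
        let ?s = "g \<otimes>\<^bsub>G\<^esub> inv\<^bsub>G\<^esub> k"
        have "k = inv\<^bsub>G\<^esub> ?s \<otimes>\<^bsub>G\<^esub> g" using k g by (simp add: G.inv_mult_group G.m_assoc)
        have "?s \<notin> ?S"
        proof
          assume "?s \<in> ?S"
          with True have "inv\<^bsub>G\<^esub> ?s \<otimes>\<^bsub>G\<^esub> g \<in> ?T" by (intro image_eqI[of _ _ "(?s, g)"]) auto
          with \<open>k = _\<close> k show False by simp
        qed
        then show "proj ?s x = \<zero>" using k g x left_ideal_subset[OF I] by (intro supp) auto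
      qed
      then show ?thesis using a g by blast
    next
      case False
      then show ?thesis using supp[OF g False] xC by simp
    qed
  qed
  then show "\<exists>e\<in>carrier (regular_module R). \<forall>x\<in>I. f x = x \<odot>\<^bsub>regular_module R\<^esub> e"
    using a(1) by auto
qed

section \<open>From injectivity to graded injectivity\<close>

lemma graded_left_module_regular: "graded_left_module G R Rgr (regular_module R) Rgr"
proof -
  have M: "left_module R (regular_module R)" by (rule left_module_regular_module)
  have "internal_direct_sum (regular_module R) (carrier G) Rgr"
    using left_module.axioms(2)[OF M]
    by (intro internal_direct_sum_pullback[where f = id and \<sigma> = id]) auto
  with M show ?thesis by (auto simp: graded_left_module_def graded_mult)
qed

lemma component_smult:
  assumes M: "graded_left_module G R Rgr M Mgr"
    and "r \<in> Rgr s" "s \<in> carrier G" "g \<in> carrier G" "x \<in> carrier M"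
  shows "component M (carrier G) Mgr g (r \<odot>\<^bsub>M\<^esub> x) =
    r \<odot>\<^bsub>M\<^esub> component M (carrier G) Mgr (inv\<^bsub>G\<^esub> s \<otimes>\<^bsub>G\<^esub> g) x"
proof -
  interpret L: left_module R M using M by (simp add: graded_left_module_def)
  interpret M: direct_sum M "carrier G" Mgr
    using M by unfold_locales (simp add: graded_left_module_def)
  show ?thesis
    using \<open>x \<in> carrier M\<close>
  proof (induction rule: M.homogeneous_induct)
    case zero
    then show ?case using assms by simp
  next
    case (homogeneous k x)
    have "r \<odot>\<^bsub>M\<^esub> x \<in> Mgr (s \<otimes>\<^bsub>G\<^esub> k)" using M assms homogeneous by (simp add: graded_left_module_def)
    then have "M.proj g (r \<odot>\<^bsub>M\<^esub> x) = (if g = s \<otimes>\<^bsub>G\<^esub> k then r \<odot>\<^bsub>M\<^esub> x else \<zero>\<^bsub>M\<^esub>)"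
      using assms homogeneous by (intro M.proj_of_homogeneous) auto
    also have "\<dots> = r \<odot>\<^bsub>M\<^esub> (if inv\<^bsub>G\<^esub> s \<otimes>\<^bsub>G\<^esub> g = k then x else \<zero>\<^bsub>M\<^esub>)"
      using assms homogeneous by auto
    also have "\<dots> = r \<odot>\<^bsub>M\<^esub> M.proj (inv\<^bsub>G\<^esub> s \<otimes>\<^bsub>G\<^esub> g) x"
      using assms homogeneous by (subst M.proj_of_homogeneous[of x k]) auto
    finally show ?case .
  next
    case (add x y)
    then show ?case using assms by (simp add: L.smult_r_distr)
  qed
qed

text \<open>An extension \<open>k\<close> that ignores degrees is replaced by the sum
  \<open>h\<close> of the maps \<open>proj g \<circ> k \<circ> M.proj g\<close>. It agrees with
  \<open>f\<close> on \<open>N\<close> because \<open>i\<close> and \<open>f\<close> preserve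
  degrees.\<close>

lemma graded_injective_if_injective:
  assumes inj: "injective_module TYPE('u) R (regular_module R)"
  shows "graded_injective_module TYPE('u) G R Rgr (regular_module R) Rgr"
  unfolding graded_injective_module_def
proof (intro conjI allI impI graded_left_module_regular, elim conjE)
  fix N M :: "('a, 'u) module" and Ngr Mgr i f
  assume N: "graded_left_module G R Rgr N Ngr" and M: "graded_left_module G R Rgr M Mgr"
    and i: "i \<in> graded_hom G R N Ngr M Mgr" "inj_on i (carrier N)"
    and f: "f \<in> graded_hom G R N Ngr (regular_module R) Rgr"
  have "left_module R N" "left_module R M" "i \<in> left_module_hom R N M"
      "f \<in> left_module_hom R N (regular_module R)"
    using N M i f by (auto simp: graded_left_module_def graded_hom_def)
  then obtain k where kM: "k \<in> left_module_hom R M (regular_module R)" and k: "\<forall>x\<in>carrier N. k (i x) = f x"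
    using inj i(2) unfolding injective_module_def by blast
  interpret LM: left_module R M by fact
  interpret M: direct_sum M "carrier G" Mgr
    using M by unfold_locales (simp add: graded_left_module_def)
  interpret LN: left_module R N by fact
  interpret N: direct_sum N "carrier G" Ngr
    using N by unfold_locales (simp add: graded_left_module_def)
  have kC [simp]: "k x \<in> carrier R" if "x \<in> carrier M" for x
    using kM that by (auto simp: left_module_hom_def)
  have kadd: "k (x \<oplus>\<^bsub>M\<^esub> y) = k x \<oplus> k y" if "x \<in> carrier M" "y \<in> carrier M" for x y
    using kM that by (auto simp: left_module_hom_def)
  have kmult: "k (a \<odot>\<^bsub>M\<^esub> x) = a \<otimes> k x" if "a \<in> carrier R" "x \<in> carrier M" for a x
    using kM that by (auto simp: left_module_hom_def)
  have iC: "i x \<in> carrier M" and fC: "f x \<in> carrier R" if "x \<in> carrier N" for x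
    using i f that by (auto simp: graded_hom_def left_module_hom_def)
  have iadd: "i (x \<oplus>\<^bsub>N\<^esub> y) = i x \<oplus>\<^bsub>M\<^esub> i y" and fadd: "f (x \<oplus>\<^bsub>N\<^esub> y) = f x \<oplus> f y"
    if "x \<in> carrier N" "y \<in> carrier N" for x y
    using i f that by (auto simp: graded_hom_def left_module_hom_def)
  \<comment> \<open>The support of \<open>M\<close> may be infinite; finite support of the target
    makes the sum exist.\<close>
  have "\<exists>y\<in>carrier R. \<forall>g\<in>carrier G. proj g y = proj g (k (M.proj g x))" if "x \<in> carrier M" for x
    using that by (intro ex_proj_eq proj_homogeneous kC) auto
  then obtain h where hC: "\<And>x. x \<in> carrier M \<Longrightarrow> h x \<in> carrier R"
    and h: "\<And>x g. x \<in> carrier M \<Longrightarrow> g \<in> carrier G \<Longrightarrow> proj g (h x) = proj g (k (M.proj g x))"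
    by metis
  have hadd: "h (x \<oplus>\<^bsub>M\<^esub> y) = h x \<oplus> h y" if x: "x \<in> carrier M" and y: "y \<in> carrier M" for x y
  proof (rule proj_ext)
    fix g assume g: "g \<in> carrier G"
    show "proj g (h (x \<oplus>\<^bsub>M\<^esub> y)) = proj g (h x \<oplus> h y)"
      using x y g hC[OF x] hC[OF y] by (simp add: h kadd)
  qed (use x y hC in auto)
  have k0: "k \<zero>\<^bsub>M\<^esub> = \<zero>" using kmult[of \<zero> "\<zero>\<^bsub>M\<^esub>"] by simp
  have h_homogeneous: "h x = proj g (k x)" if g: "g \<in> carrier G" and x: "x \<in> Mgr g" for g x
  proof (rule proj_ext)
    have xC: "x \<in> carrier M" using g x by simp
    show "h x \<in> carrier R" "proj g (k x) \<in> carrier R" using xC g hC by auto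
    fix g' assume g': "g' \<in> carrier G"
    have "k (M.proj g' x) = (if g' = g then k x else \<zero>)"
      using M.proj_of_homogeneous[OF x g' g] by (simp add: k0)
    then show "proj g' (h x) = proj g' (proj g (k x))"
      using xC g g' by (simp add: h proj_proj)
  qed
  have hmult: "h (a \<odot>\<^bsub>M\<^esub> x) = a \<otimes> h x" if a: "a \<in> carrier R" and x: "x \<in> carrier M" for a x
    using a
  proof (induction rule: homogeneous_induct)
    case zero
    have "h \<zero>\<^bsub>M\<^esub> = \<zero>" using h_homogeneous[of "\<one>\<^bsub>G\<^esub>" "\<zero>\<^bsub>M\<^esub>"] k0 by simp
    then show ?case using x hC by simp
  next
    case (homogeneous u a)
    have aC: "a \<in> carrier R" using homogeneous by simp
    show ?case
    proof (rule proj_ext)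
      show "h (a \<odot>\<^bsub>M\<^esub> x) \<in> carrier R" "a \<otimes> h x \<in> carrier R" using aC x hC by auto
      fix g assume g: "g \<in> carrier G"
      let ?g = "inv\<^bsub>G\<^esub> u \<otimes>\<^bsub>G\<^esub> g"
      have g': "?g \<in> carrier G" using g homogeneous by simp
      \<comment> \<open>Multiplication by \<open>a\<close> of degree \<open>u\<close> shifts the
        inner projection in \<open>M\<close> and the outer one in \<open>R\<close> by the same
        amount, so it commutes with \<open>h\<close>.\<close>
      have "proj g (h (a \<odot>\<^bsub>M\<^esub> x)) = proj g (k (a \<odot>\<^bsub>M\<^esub> M.proj ?g x))"
        using aC x g homogeneous component_smult[OF M, of a u g x] by (simp add: h)
      also have "\<dots> = proj g (a \<otimes> k (M.proj ?g x))"
        using aC M.proj_closed[OF x g'] by (simp add: kmult)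
      also have "\<dots> = a \<otimes> proj ?g (k (M.proj ?g x))"
        using homogeneous g M.proj_closed[OF x g'] by (intro proj_mult_left) auto
      also have "\<dots> = a \<otimes> proj ?g (h x)" using h[OF x g'] by simp
      also have "\<dots> = proj g (a \<otimes> h x)"
        using homogeneous g hC[OF x] by (intro proj_mult_left[symmetric]) auto
      finally show "proj g (h (a \<odot>\<^bsub>M\<^esub> x)) = proj g (a \<otimes> h x)" .
    qed
  next
    case (add a b)
    then show ?case using x hC by (simp add: LM.smult_l_distr l_distr hadd)
  qed
  have "h (i x) = f x" if "x \<in> carrier N" for x
    using that
  proof (induction rule: N.homogeneous_induct)
    case zero
    have z: "i \<zero>\<^bsub>N\<^esub> = \<zero>\<^bsub>M\<^esub>" "f \<zero>\<^bsub>N\<^esub> = \<zero>"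
      using iadd[of "\<zero>\<^bsub>N\<^esub>" "\<zero>\<^bsub>N\<^esub>"] iC[of "\<zero>\<^bsub>N\<^esub>"] fadd[of "\<zero>\<^bsub>N\<^esub>" "\<zero>\<^bsub>N\<^esub>"] fC[of "\<zero>\<^bsub>N\<^esub>"] by auto
    then show ?case using h_homogeneous[of "\<one>\<^bsub>G\<^esub>" "\<zero>\<^bsub>M\<^esub>"] k0 by simp
  next
    case (homogeneous g x)
    then have "i x \<in> Mgr g" "f x \<in> Rgr g" "x \<in> carrier N" using i f by (auto simp: graded_hom_def image_subset_iff)
    then show ?case using homogeneous k h_homogeneous[of g "i x"] by simp
  next
    case (add x y)
    then show ?case by (simp add: iadd fadd iC hadd)
  qed
  moreover have "h \<in> graded_hom G R M Mgr (regular_module R) Rgr"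
    using hC hadd hmult h_homogeneous
    by (auto simp: graded_hom_def left_module_hom_def)
  ultimately show "\<exists>h\<in>graded_hom G R M Mgr (regular_module R) Rgr. \<forall>x\<in>carrier N. h (i x) = f x"
    by blast
qed

end

theorem proposition5p4:
  fixes G :: "('g, 'b) monoid_scheme"
    and R :: "('a, 'r) ring_scheme"
    and Rgr :: "'g \<Rightarrow> 'a set"
  assumes "group G"
    and "graded_ring G R Rgr"
    and "finite_support G R Rgr"
  shows "graded_quasi_frobenius TYPE('a + 'v) G R Rgr \<longleftrightarrow> quasi_frobenius TYPE('a + 'w) R"
proof -
  interpret G: group G by fact
  interpret R: ring R using assms(2) by (simp add: graded_ring_def)
  interpret finite_support_graded_ring G R Rgr
    using assms(2,3) by unfold_locales (auto simp: graded_ring_def finite_support_def)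
  show ?thesis
  proof
    assume qf: "graded_quasi_frobenius TYPE('a + 'v) G R Rgr"
    \<comment> \<open>Baer's condition mediates between the unrelated universes
      \<open>'a + 'v\<close> and \<open>'a + 'w\<close>.\<close>
    then have "baer_condition R (regular_module R)"
      by (auto simp: graded_quasi_frobenius_def intro: baer_condition_if_graded_injective)
    then have "injective_module TYPE('a + 'w) R (regular_module R)"
      by (intro baer_criterion R.left_module_regular_module)
    with qf show "quasi_frobenius TYPE('a + 'w) R"
      by (auto simp: quasi_frobenius_def graded_quasi_frobenius_def R.ring_axioms
          intro: left_noetherian_if_graded)
  next
    assume qf: "quasi_frobenius TYPE('a + 'w) R"
    then have "baer_condition R (regular_module R)"
      by (auto simp: quasi_frobenius_def intro: injective_imp_baer_condition)
    \<comment> \<open>The change of universe is made for ungraded injectivity; the passage to graded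
      modules then stays within \<open>'a + 'v\<close>.\<close>
    then have "injective_module TYPE('a + 'v) R (regular_module R)"
      by (intro baer_criterion R.left_module_regular_module)
    with qf assms(2) show "graded_quasi_frobenius TYPE('a + 'v) G R Rgr"
      by (auto simp: quasi_frobenius_def graded_quasi_frobenius_def
          intro: graded_noetherian_if_left_noetherian graded_injective_if_injective)
  qed
qed

end
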